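(* Let $E(H,K)\equiv e\to H\xrightarrow{i} G\xrightarrow{\beta} K\to e$ be a central extension of multiplicative Lie algebras. Then there is an exact sequence $$e\to Z^1_{ML(\Gamma)}(K,H)\xrightarrow{\,i\,}\mathrm{Aut}_H(G)\xrightarrow{\Pi}\mathrm{Aut}(H)\times\mathrm{Aut}(K)\xrightarrow{\chi}H^2_{ML(\Gamma)}(K,H),$$ where $\Pi(\phi)=(\alpha,\eta)$ with $\alpha=\phi|_H$, $\eta(x)=\beta(\phi(t(x)))$, and $\chi(\alpha,\eta)=(s_{\alpha,\eta},s'_{\alpha,\eta},\Gamma)B^2_{ML(\Gamma)}(K,H)$.
   Context: A multiplicative Lie algebra is a triple $(G,\cdot,\star)$ where $(G,\cdot)$ is a (possibly non-abelian) group with identity $e$ and $\star$ is a binary operation such that for all $x,y,z\in G$, writing ${}^zx=zxz^{-1}$: $x\star x=e$; $x\star(yz)=(x\star y)\cdot{}^y(x\star z)$; $(xy)\star z={}^x(y\star z)\cdot(x\star z)$; $((x\star y)\star{}^yz)((y\star z)\star{}^zx)((z\star x)\star{}^xy)=e$; ${}^z(x\star y)={}^zx\star{}^zy$. Homomorphisms preserve both operations, and $\mathrm{Aut}$ denotes the group of automorphisms of a multiplicative Lie algebra. A central extension $E(H,K)\equiv e\to H\xrightarrow{i} G\xrightarrow{\beta}K\to e$ is a short exact sequence of multiplicative Lie algebras in which $H$ (identified with $i(H)=\ker\beta$) is contained in $Z(G)\cap LZ(G)$, where $Z(G)$ is the group center and $LZ(G)=\{x\in G: x\star y=e\ \forall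 y\in G\}$; in particular $\star$ is trivial on $H$. A transversal is a map $t:K\to G$ with $\beta(t(x))=x$ for all $x\in K$ and $t(e)=e$. The associated maps are $f(x,y)=t(x)t(y)t(xy)^{-1}\in H$, $h(x,y)=(t(x)\star t(y))\,t(x\star y)^{-1}\in H$ and $\Gamma_x\in\mathrm{End}(H)$, $\Gamma_x(a)=t(x)\star a$; for a central extension $\Gamma_x(a)=e$ for all $x\in K$, $a\in H$. Cohomology. $Z^1_{ML(\Gamma)}(K,H)$ is the abelian group (pointwise operation) of maps $\nu:K\to H$ with $\nu(xy)=\nu(x)\nu(y)$ and $\nu(x\star y)=\Gamma_x(\nu(y))\Gamma_y(\nu(x)^{-1})$ for all $x,y\in K$. For the fixed $\Gamma$, $Z^2_{ML(\Gamma)}(K,H)$ is the abelian group (under $(f,h,\Gamma)(f',h',\Gamma)=(ff',hh',\Gamma)$) of triples $(f,h,\Gamma)$ (multiplicative center 2-cocycles) with $f,h:K\times K\to H$ such that, writing $c(z,w)=f(z^{-1},zw)^{-1}f(zw,z^{-1})$, for all $x,y,z\in K$: $f(e,x)=f(x,e)=e$; $h(x,x)=h(x,e)=h(e,x)=e$; $f(x,y)f(xy,z)=f(y,z)f(x,yz)$; $c(y,x\star z)\,f(x\star y,{}^y(x\star z))\,h(x,y)h(x,z)=\Gamma_x(f(y,z))\,h(x,yz)$; $c(x,y\star z)\,f({}^x(y\star z),x\star z)\,h(x,z)h(y,z)=\Gamma_z(f(x,y)^{-1})\,h(xy,z)$; $\Gamma_x(c(z,y))\,\Gamma_y(c(z,x)^{-1})\,h({}^zx,{}^zy)=c(z,x\star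 y)\,h(x,y)$; $\Gamma_{x\star y}(c(y,z))\Gamma_{y\star z}(c(z,x))\Gamma_{z\star x}(c(x,y))\,\Gamma_z(h(x,y)^{-1})\Gamma_x(h(y,z)^{-1})\Gamma_y(h(z,x)^{-1})\,h(x\star y,{}^yz)\,h(y\star z,{}^zx)\,h(z\star x,{}^xy)\,f((x\star y)\star{}^yz,(y\star z)\star{}^zx)\,f(((z\star x)\star{}^xy)^{-1},(z\star x)\star{}^xy)=e$. $B^2_{ML(\Gamma)}(K,H)$ is the subgroup of those triples (2-coboundaries) for which there is a map $\lambda:K\to H$ with $\lambda(e)=e$, $f(x,y)=\lambda(x)\lambda(y)\lambda(xy)^{-1}$ and $h(x,y)=\Gamma_x(\lambda(y))\Gamma_y(\lambda(x)^{-1})\lambda(x\star y)^{-1}$ for all $x,y\in K$. $H^2_{ML(\Gamma)}(K,H)=Z^2_{ML(\Gamma)}(K,H)/B^2_{ML(\Gamma)}(K,H)$. Groups and maps. $\mathrm{Aut}_H(G)=\{\phi\in\mathrm{Aut}(G):\phi(H)=H\}$. The map $i$ sends $\nu$ to the automorphism $\phi_\nu$ with $\phi_\nu(a\,t(x))=a\,\nu(x)\,t(x)$ for $a\in H$, $x\in K$. With $f,h$ the maps associated with $t$, $s_{\alpha,\eta}(x,y)=f(\eta(x),\eta(y))\,\alpha(f(x,y))^{-1}$ and $s'_{\alpha,\eta}(x,y)=h(\eta(x),\eta(y))\,\alpha(h(x,y))^{-1}$. The map $\chi$ need not be a homomorphism; exactness at $\mathrm{Aut}(H)\times\mathrm{Aut}(K)$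 means that $\mathrm{Im}(\Pi)$ is the set of pairs with trivial $\chi$-class. *)

theory Defs
  imports "HOL-Algebra.Bij" "HOL-Algebra.Coset"
begin

section \<open>Multiplicative Lie algebras\<close>

record 'a mla = "'a monoid" +
  star :: "'a \<Rightarrow> 'a \<Rightarrow> 'a" (infixl \<open>\<star>\<index>\<close> 70)

definition conjg :: "('a, 'm) monoid_scheme \<Rightarrow> 'a \<Rightarrow> 'a \<Rightarrow> 'a" where
  "conjg G z x = z \<otimes>\<^bsub>G\<^esub> x \<otimes>\<^bsub>G\<^esub> inv\<^bsub>G\<^esub> z"

locale mult_lie_algebra = group G for G (structure) +
  assumes star_closed: "\<lbrakk>x \<in> carrier G; y \<in> carrier G\<rbrakk> \<Longrightarrow> x \<star> y \<in> carrier G"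
    and star_self: "x \<in> carrier G \<Longrightarrow> x \<star> x = \<one>"
    and star_mult_right: "\<lbrakk>x \<in> carrier G; y \<in> carrier G; z \<in> carrier G\<rbrakk>
      \<Longrightarrow> x \<star> (y \<otimes> z) = (x \<star> y) \<otimes> conjg G y (x \<star> z)"
    and star_mult_left: "\<lbrakk>x \<in> carrier G; y \<in> carrier G; z \<in> carrier G\<rbrakk>
      \<Longrightarrow> (x \<otimes> y) \<star> z = conjg G x (y \<star> z) \<otimes> (x \<star> z)"
    and star_jacobi: "\<lbrakk>x \<in> carrier G; y \<in> carrier G; z \<in> carrier G\<rbrakk>
      \<Longrightarrow> ((x \<star> y) \<star> conjg G y z) \<otimes> ((y \<star> z) \<star> conjg G z x) \<otimes> ((z \<star> x) \<star> conjg G x y) = \<one>"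
    and conjg_star: "\<lbrakk>x \<in> carrier G; y \<in> carrier G; z \<in> carrier G\<rbrakk>
      \<Longrightarrow> conjg G z (x \<star> y) = conjg G z x \<star> conjg G z y"

definition mla_hom :: "('a, 'm) mla_scheme \<Rightarrow> ('b, 'n) mla_scheme \<Rightarrow> ('a \<Rightarrow> 'b) set" where
  "mla_hom G K = {\<phi> \<in> hom G K.
     \<forall>x\<in>carrier G. \<forall>y\<in>carrier G. \<phi> (x \<star>\<^bsub>G\<^esub> y) = \<phi> x \<star>\<^bsub>K\<^esub> \<phi> y}"

definition mla_Aut :: "('a, 'm) mla_scheme \<Rightarrow> ('a \<Rightarrow> 'a) monoid" where
  "mla_Aut G = BijGroup (carrier G) \<lparr>carrier := mla_hom G G \<inter> Bij (carrier G)\<rparr>"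

text \<open>The automorphisms of \<open>G\<close> that map the subset \<open>N\<close> onto itself.\<close>

definition mla_Aut_stab :: "'a set \<Rightarrow> ('a, 'm) mla_scheme \<Rightarrow> ('a \<Rightarrow> 'a) monoid" where
  "mla_Aut_stab N G = mla_Aut G \<lparr>carrier := {\<phi> \<in> carrier (mla_Aut G). \<phi> ` N = N}\<rparr>"

definition grp_center :: "('a, 'm) monoid_scheme \<Rightarrow> 'a set" where
  "grp_center G = {x \<in> carrier G. \<forall>y\<in>carrier G. x \<otimes>\<^bsub>G\<^esub> y = y \<otimes>\<^bsub>G\<^esub> x}"

definition lie_center :: "('a, 'm) mla_scheme \<Rightarrow> 'a set" where
  "lie_center G = {x \<in> carrier G. \<forall>y\<in>carrier G. x \<star>\<^bsub>G\<^esub> y = \<one>\<^bsub>G\<^esub>}"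

section \<open>Central extensions\<close>

text \<open>
  \<open>H\<close> is kept as a structure of its own, embedded in \<open>G\<close> by \<open>\<iota>\<close>. An element of \<open>\<iota> ` carrier H\<close> is
  read as an element of \<open>H\<close> by means of \<^term>\<open>inv_into (carrier H) \<iota>\<close>.
\<close>

locale central_extension =
  H: mult_lie_algebra H + G: mult_lie_algebra G + K: mult_lie_algebra K
  for H (structure) and G (structure) and K (structure) +
  fixes \<iota> :: "'h \<Rightarrow> 'g" and \<beta> :: "'g \<Rightarrow> 'k"
  assumes incl_hom: "\<iota> \<in> mla_hom H G"
    and incl_inj: "inj_on \<iota> (carrier H)"
    and proj_hom: "\<beta> \<in> mla_hom G K"
    and proj_surj: "\<beta> ` carrier G = carrier K"
    and incl_image: "\<iota> ` carrier H = kernel G K \<beta>"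
    and central: "\<iota> ` carrier H \<subseteq> grp_center G \<inter> lie_center G"

definition transversal ::
  "('g, 'm) mla_scheme \<Rightarrow> ('k, 'n) mla_scheme \<Rightarrow> ('g \<Rightarrow> 'k) \<Rightarrow> ('k \<Rightarrow> 'g) \<Rightarrow> bool" where
  "transversal G K \<beta> t \<longleftrightarrow>
     t \<in> carrier K \<rightarrow> carrier G \<and> (\<forall>x\<in>carrier K. \<beta> (t x) = x) \<and> t \<one>\<^bsub>K\<^esub> = \<one>\<^bsub>G\<^esub>"

text \<open>The maps \<open>f\<close>, \<open>h\<close> and \<open>\<Gamma>\<close> associated with a transversal \<open>t\<close>.\<close>

definition assoc_f ::
  "('h, 'l) mla_scheme \<Rightarrow> ('g, 'm) mla_scheme \<Rightarrow> ('k, 'n) mla_scheme \<Rightarrow> ('h \<Rightarrow> 'g) \<Rightarrow> ('k \<Rightarrow> 'g)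
    \<Rightarrow> 'k \<times> 'k \<Rightarrow> 'h" where
  "assoc_f H G K \<iota> t = (\<lambda>(x, y) \<in> carrier K \<times> carrier K.
     inv_into (carrier H) \<iota> (t x \<otimes>\<^bsub>G\<^esub> t y \<otimes>\<^bsub>G\<^esub> inv\<^bsub>G\<^esub> (t (x \<otimes>\<^bsub>K\<^esub> y))))"

definition assoc_h ::
  "('h, 'l) mla_scheme \<Rightarrow> ('g, 'm) mla_scheme \<Rightarrow> ('k, 'n) mla_scheme \<Rightarrow> ('h \<Rightarrow> 'g) \<Rightarrow> ('k \<Rightarrow> 'g)
    \<Rightarrow> 'k \<times> 'k \<Rightarrow> 'h" where
  "assoc_h H G K \<iota> t = (\<lambda>(x, y) \<in> carrier K \<times> carrier K.
     inv_into (carrier H) \<iota> ((t x \<star>\<^bsub>G\<^esub> t y) \<otimes>\<^bsub>G\<^esub> inv\<^bsub>G\<^esub> (t (x \<star>\<^bsub>K\<^esub> y))))"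

definition assoc_\<Gamma> ::
  "('h, 'l) mla_scheme \<Rightarrow> ('g, 'm) mla_scheme \<Rightarrow> ('k, 'n) mla_scheme \<Rightarrow> ('h \<Rightarrow> 'g) \<Rightarrow> ('k \<Rightarrow> 'g)
    \<Rightarrow> 'k \<Rightarrow> 'h \<Rightarrow> 'h" where
  "assoc_\<Gamma> H G K \<iota> t = (\<lambda>x \<in> carrier K. \<lambda>a \<in> carrier H.
     inv_into (carrier H) \<iota> (t x \<star>\<^bsub>G\<^esub> \<iota> a))"

section \<open>Cohomology\<close>

text \<open>
  Cochains are extensional functions, so that equality of cochains is equality on the carriers.
\<close>

definition Z1_ML ::
  "('k, 'n) mla_scheme \<Rightarrow> ('h, 'l) mla_scheme \<Rightarrow> ('k \<Rightarrow> 'h \<Rightarrow> 'h) \<Rightarrow> ('k \<Rightarrow> 'h) monoid" where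
  "Z1_ML K H \<Gamma> =
     \<lparr>carrier = {\<nu> \<in> carrier K \<rightarrow>\<^sub>E carrier H. \<forall>x\<in>carrier K. \<forall>y\<in>carrier K.
          \<nu> (x \<otimes>\<^bsub>K\<^esub> y) = \<nu> x \<otimes>\<^bsub>H\<^esub> \<nu> y \<and>
          \<nu> (x \<star>\<^bsub>K\<^esub> y) = \<Gamma> x (\<nu> y) \<otimes>\<^bsub>H\<^esub> \<Gamma> y (inv\<^bsub>H\<^esub> (\<nu> x))},
      mult = \<lambda>\<nu> \<mu>. \<lambda>x \<in> carrier K. \<nu> x \<otimes>\<^bsub>H\<^esub> \<mu> x,
      one = \<lambda>x \<in> carrier K. \<one>\<^bsub>H\<^esub>\<rparr>"

text \<open>
  For the \<open>f\<close> associated with a transversal \<open>t\<close>, \<open>conj_defect K H f z w\<close> is the factor by which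
  the conjugate of \<open>t w\<close> by \<open>t z\<close> differs from \<open>t\<close> of the conjugate of \<open>w\<close> by \<open>z\<close>.
\<close>

definition conj_defect ::
  "('k, 'n) mla_scheme \<Rightarrow> ('h, 'l) mla_scheme \<Rightarrow> ('k \<times> 'k \<Rightarrow> 'h) \<Rightarrow> 'k \<Rightarrow> 'k \<Rightarrow> 'h" where
  "conj_defect K H f z w =
     inv\<^bsub>H\<^esub> (f (inv\<^bsub>K\<^esub> z, z \<otimes>\<^bsub>K\<^esub> w)) \<otimes>\<^bsub>H\<^esub> f (z \<otimes>\<^bsub>K\<^esub> w, inv\<^bsub>K\<^esub> z)"

definition cocycle2_ML ::
  "('k, 'n) mla_scheme \<Rightarrow> ('h, 'l) mla_scheme \<Rightarrow> ('k \<Rightarrow> 'h \<Rightarrow> 'h)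
    \<Rightarrow> ('k \<times> 'k \<Rightarrow> 'h) \<Rightarrow> ('k \<times> 'k \<Rightarrow> 'h) \<Rightarrow> bool" where
  "cocycle2_ML K H \<Gamma> f h \<longleftrightarrow>
    f \<in> carrier K \<times> carrier K \<rightarrow>\<^sub>E carrier H \<and>
    h \<in> carrier K \<times> carrier K \<rightarrow>\<^sub>E carrier H \<and>
    (\<forall>x\<in>carrier K. f (\<one>\<^bsub>K\<^esub>, x) = \<one>\<^bsub>H\<^esub> \<and> f (x, \<one>\<^bsub>K\<^esub>) = \<one>\<^bsub>H\<^esub> \<and>
       h (x, x) = \<one>\<^bsub>H\<^esub> \<and> h (x, \<one>\<^bsub>K\<^esub>) = \<one>\<^bsub>H\<^esub> \<and> h (\<one>\<^bsub>K\<^esub>, x) = \<one>\<^bsub>H\<^esub>) \<and>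
    (\<forall>x\<in>carrier K. \<forall>y\<in>carrier K. \<forall>z\<in>carrier K.
       f (x, y) \<otimes>\<^bsub>H\<^esub> f (x \<otimes>\<^bsub>K\<^esub> y, z) = f (y, z) \<otimes>\<^bsub>H\<^esub> f (x, y \<otimes>\<^bsub>K\<^esub> z) \<and>
       conj_defect K H f y (x \<star>\<^bsub>K\<^esub> z) \<otimes>\<^bsub>H\<^esub> f (x \<star>\<^bsub>K\<^esub> y, conjg K y (x \<star>\<^bsub>K\<^esub> z)) \<otimes>\<^bsub>H\<^esub> h (x, y) \<otimes>\<^bsub>H\<^esub> h (x, z)
         = \<Gamma> x (f (y, z)) \<otimes>\<^bsub>H\<^esub> h (x, y \<otimes>\<^bsub>K\<^esub> z) \<and>
       conj_defect K H f x (y \<star>\<^bsub>K\<^esub> z) \<otimes>\<^bsub>H\<^esub> f (conjg K x (y \<star>\<^bsub>K\<^esub> z), x \<star>\<^bsub>K\<^esub> z) \<otimes>\<^bsub>H\<^esub> h (x, z) \<otimes>\<^bsub>H\<^esub> h (y, z)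
         = \<Gamma> z (inv\<^bsub>H\<^esub> (f (x, y))) \<otimes>\<^bsub>H\<^esub> h (x \<otimes>\<^bsub>K\<^esub> y, z) \<and>
       \<Gamma> x (conj_defect K H f z y) \<otimes>\<^bsub>H\<^esub> \<Gamma> y (inv\<^bsub>H\<^esub> (conj_defect K H f z x)) \<otimes>\<^bsub>H\<^esub> h (conjg K z x, conjg K z y)
         = conj_defect K H f z (x \<star>\<^bsub>K\<^esub> y) \<otimes>\<^bsub>H\<^esub> h (x, y) \<and>
       \<Gamma> (x \<star>\<^bsub>K\<^esub> y) (conj_defect K H f y z) \<otimes>\<^bsub>H\<^esub>
       \<Gamma> (y \<star>\<^bsub>K\<^esub> z) (conj_defect K H f z x) \<otimes>\<^bsub>H\<^esub>
       \<Gamma> (z \<star>\<^bsub>K\<^esub> x) (conj_defect K H f x y) \<otimes>\<^bsub>H\<^esub>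
       \<Gamma> z (inv\<^bsub>H\<^esub> (h (x, y))) \<otimes>\<^bsub>H\<^esub> \<Gamma> x (inv\<^bsub>H\<^esub> (h (y, z))) \<otimes>\<^bsub>H\<^esub> \<Gamma> y (inv\<^bsub>H\<^esub> (h (z, x))) \<otimes>\<^bsub>H\<^esub>
       h (x \<star>\<^bsub>K\<^esub> y, conjg K y z) \<otimes>\<^bsub>H\<^esub> h (y \<star>\<^bsub>K\<^esub> z, conjg K z x) \<otimes>\<^bsub>H\<^esub> h (z \<star>\<^bsub>K\<^esub> x, conjg K x y) \<otimes>\<^bsub>H\<^esub>
       f ((x \<star>\<^bsub>K\<^esub> y) \<star>\<^bsub>K\<^esub> conjg K y z, (y \<star>\<^bsub>K\<^esub> z) \<star>\<^bsub>K\<^esub> conjg K z x) \<otimes>\<^bsub>H\<^esub>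
       f (inv\<^bsub>K\<^esub> ((z \<star>\<^bsub>K\<^esub> x) \<star>\<^bsub>K\<^esub> conjg K x y), (z \<star>\<^bsub>K\<^esub> x) \<star>\<^bsub>K\<^esub> conjg K x y)
         = \<one>\<^bsub>H\<^esub>)"

type_synonym ('k, 'h) cochain2 = "('k \<times> 'k \<Rightarrow> 'h) \<times> ('k \<times> 'k \<Rightarrow> 'h) \<times> ('k \<Rightarrow> 'h \<Rightarrow> 'h)"

definition Z2_ML ::
  "('k, 'n) mla_scheme \<Rightarrow> ('h, 'l) mla_scheme \<Rightarrow> ('k \<Rightarrow> 'h \<Rightarrow> 'h) \<Rightarrow> ('k, 'h) cochain2 monoid" where
  "Z2_ML K H \<Gamma> =
     \<lparr>carrier = {(f, h, \<Gamma>') | f h \<Gamma>'. \<Gamma>' = \<Gamma> \<and> cocycle2_ML K H \<Gamma> f h},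
      mult = \<lambda>(f, h, _) (f', h', _).
        (\<lambda>p \<in> carrier K \<times> carrier K. f p \<otimes>\<^bsub>H\<^esub> f' p,
         \<lambda>p \<in> carrier K \<times> carrier K. h p \<otimes>\<^bsub>H\<^esub> h' p, \<Gamma>),
      one = (\<lambda>p \<in> carrier K \<times> carrier K. \<one>\<^bsub>H\<^esub>, \<lambda>p \<in> carrier K \<times> carrier K. \<one>\<^bsub>H\<^esub>, \<Gamma>)\<rparr>"

definition B2_ML ::
  "('k, 'n) mla_scheme \<Rightarrow> ('h, 'l) mla_scheme \<Rightarrow> ('k \<Rightarrow> 'h \<Rightarrow> 'h) \<Rightarrow> ('k, 'h) cochain2 set" where
  "B2_ML K H \<Gamma> = {(f, h, \<Gamma>') | f h \<Gamma>'. (f, h, \<Gamma>') \<in> carrier (Z2_ML K H \<Gamma>) \<and>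
     (\<exists>l \<in> carrier K \<rightarrow> carrier H. l \<one>\<^bsub>K\<^esub> = \<one>\<^bsub>H\<^esub> \<and>
       (\<forall>x\<in>carrier K. \<forall>y\<in>carrier K.
         f (x, y) = l x \<otimes>\<^bsub>H\<^esub> l y \<otimes>\<^bsub>H\<^esub> inv\<^bsub>H\<^esub> (l (x \<otimes>\<^bsub>K\<^esub> y)) \<and>
         h (x, y) = \<Gamma> x (l y) \<otimes>\<^bsub>H\<^esub> \<Gamma> y (inv\<^bsub>H\<^esub> (l x)) \<otimes>\<^bsub>H\<^esub> inv\<^bsub>H\<^esub> (l (x \<star>\<^bsub>K\<^esub> y))))}"

definition H2_ML ::
  "('k, 'n) mla_scheme \<Rightarrow> ('h, 'l) mla_scheme \<Rightarrow> ('k \<Rightarrow> 'h \<Rightarrow> 'h) \<Rightarrow> ('k, 'h) cochain2 set monoid" where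
  "H2_ML K H \<Gamma> = Z2_ML K H \<Gamma> Mod B2_ML K H \<Gamma>"

section \<open>The maps of the exact sequence\<close>

definition i_map ::
  "('h, 'l) mla_scheme \<Rightarrow> ('g, 'm) mla_scheme \<Rightarrow> ('k, 'n) mla_scheme \<Rightarrow> ('h \<Rightarrow> 'g) \<Rightarrow> ('k \<Rightarrow> 'g)
    \<Rightarrow> ('k \<Rightarrow> 'h) \<Rightarrow> ('g \<Rightarrow> 'g)" where
  "i_map H G K \<iota> t \<nu> = (THE \<phi>. \<phi> \<in> carrier (mla_Aut G) \<and>
     (\<forall>a\<in>carrier H. \<forall>x\<in>carrier K. \<phi> (\<iota> a \<otimes>\<^bsub>G\<^esub> t x) = \<iota> a \<otimes>\<^bsub>G\<^esub> \<iota> (\<nu> x) \<otimes>\<^bsub>G\<^esub> t x))"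

definition \<Pi>_map ::
  "('h, 'l) mla_scheme \<Rightarrow> ('k, 'n) mla_scheme \<Rightarrow> ('h \<Rightarrow> 'g) \<Rightarrow> ('g \<Rightarrow> 'k) \<Rightarrow> ('k \<Rightarrow> 'g)
    \<Rightarrow> ('g \<Rightarrow> 'g) \<Rightarrow> ('h \<Rightarrow> 'h) \<times> ('k \<Rightarrow> 'k)" where
  "\<Pi>_map H K \<iota> \<beta> t \<phi> =
     (\<lambda>a \<in> carrier H. inv_into (carrier H) \<iota> (\<phi> (\<iota> a)), \<lambda>x \<in> carrier K. \<beta> (\<phi> (t x)))"

text \<open>
  Instantiated with the associated \<open>f\<close> and \<open>h\<close>, this gives \<open>s\<close> and \<open>s'\<close> for the pair \<open>(\<alpha>, \<eta>)\<close>.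
\<close>

definition twist_diff ::
  "('h, 'l) mla_scheme \<Rightarrow> ('k, 'n) mla_scheme \<Rightarrow> ('k \<times> 'k \<Rightarrow> 'h) \<Rightarrow> ('h \<Rightarrow> 'h) \<Rightarrow> ('k \<Rightarrow> 'k)
    \<Rightarrow> 'k \<times> 'k \<Rightarrow> 'h" where
  "twist_diff H K f \<alpha> \<eta> = (\<lambda>(x, y) \<in> carrier K \<times> carrier K.
     f (\<eta> x, \<eta> y) \<otimes>\<^bsub>H\<^esub> inv\<^bsub>H\<^esub> (\<alpha> (f (x, y))))"

definition \<chi>_map ::
  "('h, 'l) mla_scheme \<Rightarrow> ('g, 'm) mla_scheme \<Rightarrow> ('k, 'n) mla_scheme \<Rightarrow> ('h \<Rightarrow> 'g) \<Rightarrow> ('k \<Rightarrow> 'g)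
    \<Rightarrow> ('h \<Rightarrow> 'h) \<times> ('k \<Rightarrow> 'k) \<Rightarrow> ('k, 'h) cochain2 set" where
  "\<chi>_map H G K \<iota> t = (\<lambda>(\<alpha>, \<eta>).
     (twist_diff H K (assoc_f H G K \<iota> t) \<alpha> \<eta>,
      twist_diff H K (assoc_h H G K \<iota> t) \<alpha> \<eta>,
      assoc_\<Gamma> H G K \<iota> t)
     <#\<^bsub>Z2_ML K H (assoc_\<Gamma> H G K \<iota> t)\<^esub> B2_ML K H (assoc_\<Gamma> H G K \<iota> t))"

end

theory Submission
  imports Defs
begin

text \<open>
  A transversal \<open>t\<close> writes every element of \<open>G\<close> uniquely as \<open>\<iota> a \<otimes> t x\<close>, called \<open>elt a x\<close> below. As
  \<open>\<iota> a\<close> is central and annihilates \<open>G\<close> under \<open>\<star>\<close>, the operations become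

    \<open>elt a x \<otimes> elt b y = elt (a \<otimes> b \<otimes> f (x, y)) (x \<otimes> y)\<close> and
    \<open>elt a x \<star> elt b y = elt (h (x, y)) (x \<star> y)\<close>

  (\<open>elt_mult\<close>, \<open>elt_star\<close>). Comparing coordinates in the axioms of \<open>G\<close> shows that \<open>(f, h)\<close> is a
  cocycle (\<open>assoc_cocycle\<close>).

  Exactness comes from one description of the middle group. An automorphism of \<open>G\<close> that stabilises
  \<open>\<iota> ` carrier H\<close> induces \<open>\<alpha>\<close> on \<open>H\<close> and \<open>\<eta>\<close> on \<open>K\<close>, and must therefore be
  \<open>elt a x \<mapsto> elt (\<alpha> a \<otimes> l x) (\<eta> x)\<close> for some \<open>l\<close>. Conversely, for automorphisms \<open>\<alpha>\<close> and \<open>\<eta>\<close> such a map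
  is an automorphism if and only if, for all \<open>x\<close> and \<open>y\<close>,

    \<open>l x \<otimes> l y \<otimes> f (\<eta> x, \<eta> y) = \<alpha> (f (x, y)) \<otimes> l (x \<otimes> y)\<close> and
    \<open>h (\<eta> x, \<eta> y) = \<alpha> (h (x, y)) \<otimes> l (x \<star> y)\<close>

  (\<open>stab_twisted\<close>, \<open>twisted_hom_iff\<close>, \<open>twisted_bij\<close>). Now everything is read off from these equations.
  The kernel of \<open>\<Pi>\<close> consists of the maps with \<open>\<alpha>\<close> and \<open>\<eta>\<close> the identity. The equations then say that
  \<open>l\<close> is a homomorphism killing all \<open>x \<star> y\<close>, that is, an element of \<open>Z1_ML\<close>, and the map is its image
  under \<open>i\<close>. A pair \<open>(\<alpha>, \<eta>)\<close> is in the image of \<open>\<Pi>\<close> if and only if the equations have a solution \<open>l\<close>. Such a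
  solution is, up to inversion, a cochain whose coboundary is the cocycle that defines \<open>\<chi> (\<alpha>, \<eta>)\<close>
  (\<open>twist_diff_coboundary_iff\<close>).
\<close>

section \<open>Automorphism groups\<close>

lemma mla_homD:
  assumes "\<phi> \<in> mla_hom G K"
  shows "\<phi> \<in> hom G K"
    and "x \<in> carrier G \<Longrightarrow> \<phi> x \<in> carrier K"
    and "x \<in> carrier G \<Longrightarrow> y \<in> carrier G \<Longrightarrow> \<phi> (x \<otimes>\<^bsub>G\<^esub> y) = \<phi> x \<otimes>\<^bsub>K\<^esub> \<phi> y"
    and "x \<in> carrier G \<Longrightarrow> y \<in> carrier G \<Longrightarrow> \<phi> (x \<star>\<^bsub>G\<^esub> y) = \<phi> x \<star>\<^bsub>K\<^esub> \<phi> y"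
  using assms by (auto simp: mla_hom_def hom_def)

lemma mla_homI:
  assumes "\<And>x. x \<in> carrier G \<Longrightarrow> \<phi> x \<in> carrier K"
    and "\<And>x y. x \<in> carrier G \<Longrightarrow> y \<in> carrier G \<Longrightarrow> \<phi> (x \<otimes>\<^bsub>G\<^esub> y) = \<phi> x \<otimes>\<^bsub>K\<^esub> \<phi> y"
    and "\<And>x y. x \<in> carrier G \<Longrightarrow> y \<in> carrier G \<Longrightarrow> \<phi> (x \<star>\<^bsub>G\<^esub> y) = \<phi> x \<star>\<^bsub>K\<^esub> \<phi> y"
  shows "\<phi> \<in> mla_hom G K"
  using assms by (auto simp: mla_hom_def hom_def)

lemma carrier_mla_Aut: "carrier (mla_Aut G) = mla_hom G G \<inter> Bij (carrier G)"
  by (simp add: mla_Aut_def)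

lemma mla_AutD:
  assumes "\<phi> \<in> carrier (mla_Aut G)"
  shows "\<phi> \<in> mla_hom G G" "\<phi> \<in> Bij (carrier G)" "bij_betw \<phi> (carrier G) (carrier G)"
    "inj_on \<phi> (carrier G)" "\<phi> ` carrier G = carrier G" "\<phi> \<in> extensional (carrier G)"
  using assms by (auto simp: carrier_mla_Aut Bij_def bij_betw_def)

lemma mult_mla_Aut:
  assumes "\<phi> \<in> carrier (mla_Aut G)" "\<psi> \<in> carrier (mla_Aut G)"
  shows "\<phi> \<otimes>\<^bsub>mla_Aut G\<^esub> \<psi> = compose (carrier G) \<phi> \<psi>"
  using mla_AutD(2)[OF assms(1)] mla_AutD(2)[OF assms(2)] by (simp add: mla_Aut_def BijGroup_def)

lemma one_mla_Aut: "\<one>\<^bsub>mla_Aut G\<^esub> = (\<lambda>x\<in>carrier G. x)"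
  by (simp add: mla_Aut_def BijGroup_def)

context mult_lie_algebra
begin

lemma conjg_closed [simp, intro]:
  "z \<in> carrier G \<Longrightarrow> x \<in> carrier G \<Longrightarrow> conjg G z x \<in> carrier G"
  by (simp add: conjg_def)

lemma conjg_one [simp]: "x \<in> carrier G \<Longrightarrow> conjg G \<one> x = x" "z \<in> carrier G \<Longrightarrow> conjg G z \<one> = \<one>"
  by (simp_all add: conjg_def)

lemma conjg_eq_one:
  assumes "z \<in> carrier G" "x \<in> carrier G"
  shows "conjg G z x = \<one> \<longleftrightarrow> x = \<one>"
proof
  assume "conjg G z x = \<one>"
  then have "z \<otimes> x = \<one> \<otimes> z"
    using assms inv_solve_right'[of \<one> "z \<otimes> x" z] by (simp add: conjg_def)
  then show "x = \<one>" using assms by simp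
qed (use assms in simp)

lemma star_one_right [simp]: "x \<in> carrier G \<Longrightarrow> x \<star> \<one> = \<one>"
  using star_mult_right[of x \<one> \<one>] by (simp add: star_closed)

lemma star_one_left [simp]: "x \<in> carrier G \<Longrightarrow> \<one> \<star> x = \<one>"
  using star_mult_left[of \<one> \<one> x] by (simp add: star_closed)

text \<open>
  Only the left annihilator enters the definition of the Lie centre. It annihilates on the right as
  well, because expanding \<open>(z \<otimes> y) \<star> (z \<otimes> y) = \<one>\<close> leaves the single factor \<open>y \<star> z\<close>.
\<close>

lemma star_lie_center:
  assumes z: "z \<in> lie_center G" and y: "y \<in> carrier G"
  shows "z \<star> y = \<one>" "y \<star> z = \<one>"
proof -
  have zc: "z \<in> carrier G" and z1: "\<And>y. y \<in> carrier G \<Longrightarrow> z \<star> y = \<one>"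
    using z by (auto simp: lie_center_def)
  show "z \<star> y = \<one>" using z1 y .
  have "\<one> = (z \<otimes> y) \<star> (z \<otimes> y)"
    using zc y by (simp add: star_self)
  also have "\<dots> = conjg G z (y \<star> (z \<otimes> y))"
    using zc y by (simp add: star_mult_left z1 star_closed)
  finally have "y \<star> (z \<otimes> y) = \<one>"
    using zc y conjg_eq_one[of z "y \<star> (z \<otimes> y)"] by (simp add: star_closed)
  then show "y \<star> z = \<one>"
    using zc y by (simp add: star_mult_right star_self star_closed)
qed

lemma conjg_grp_center:
  assumes "z \<in> grp_center G" "x \<in> carrier G"
  shows "conjg G z x = x"
  using assms by (auto simp: grp_center_def conjg_def m_assoc)

lemma star_mult_central:
  assumes z: "z \<in> grp_center G \<inter> lie_center G" and x: "x \<in> carrier G" and y: "y \<in> carrier G"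
  shows "(z \<otimes> x) \<star> y = x \<star> y" "x \<star> (z \<otimes> y) = x \<star> y"
proof -
  have zc: "z \<in> carrier G" using z by (auto simp: grp_center_def)
  show "(z \<otimes> x) \<star> y = x \<star> y" "x \<star> (z \<otimes> y) = x \<star> y"
    using z zc x y by (simp_all add: star_mult_left star_mult_right star_lie_center
        conjg_grp_center star_closed)
qed

lemma subgroup_mla_Aut: "subgroup (mla_hom G G \<inter> Bij (carrier G)) (BijGroup (carrier G))"
proof (rule group.subgroupI[OF group_BijGroup])
  show "mla_hom G G \<inter> Bij (carrier G) \<subseteq> carrier (BijGroup (carrier G))"
    by (auto simp: BijGroup_def)
  have "(\<lambda>x\<in>carrier G. x) \<in> mla_hom G G"
    by (rule mla_homI) (auto simp: star_closed)
  then show "mla_hom G G \<inter> Bij (carrier G) \<noteq> {}"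
    using id_Bij by blast
next
  fix \<phi> assume \<phi>: "\<phi> \<in> mla_hom G G \<inter> Bij (carrier G)"
  have "restrict (inv_into (carrier G) \<phi>) (carrier G) \<in> mla_hom G G"
  proof (rule mla_homI)
    fix x y assume xy: "x \<in> carrier G" "y \<in> carrier G"
    show "restrict (inv_into (carrier G) \<phi>) (carrier G) x \<in> carrier G"
      using \<phi> xy by (simp add: Bij_inv_into_mem)
    show "restrict (inv_into (carrier G) \<phi>) (carrier G) (x \<otimes> y)
        = restrict (inv_into (carrier G) \<phi>) (carrier G) x
          \<otimes> restrict (inv_into (carrier G) \<phi>) (carrier G) y"
      using Bij_inv_into_lemma[of "carrier G" \<phi> "\<lambda>x y. x \<otimes> y" x y] \<phi> xy
      by (simp add: mla_homD(3))
    show "restrict (inv_into (carrier G) \<phi>) (carrier G) (x \<star> y)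
        = restrict (inv_into (carrier G) \<phi>) (carrier G) x
          \<star> restrict (inv_into (carrier G) \<phi>) (carrier G) y"
      using Bij_inv_into_lemma[of "carrier G" \<phi> "\<lambda>x y. x \<star> y" x y] \<phi> xy
      by (simp add: mla_homD(4) star_closed)
  qed
  then show "inv\<^bsub>BijGroup (carrier G)\<^esub> \<phi> \<in> mla_hom G G \<inter> Bij (carrier G)"
    using \<phi> by (simp add: inv_BijGroup restrict_inv_into_Bij)
next
  fix \<phi> \<psi> assume a: "\<phi> \<in> mla_hom G G \<inter> Bij (carrier G)" "\<psi> \<in> mla_hom G G \<inter> Bij (carrier G)"
  have "compose (carrier G) \<phi> \<psi> \<in> mla_hom G G"
    using a by (intro mla_homI) (auto simp: compose_def mla_homD star_closed)
  then show "\<phi> \<otimes>\<^bsub>BijGroup (carrier G)\<^esub> \<psi> \<in> mla_hom G G \<inter> Bij (carrier G)"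
    using a by (simp add: BijGroup_def compose_Bij)
qed

lemma group_mla_Aut: "group (mla_Aut G)"
  using subgroup.subgroup_is_group[OF subgroup_mla_Aut group_BijGroup] by (simp add: mla_Aut_def)

lemma inv_mla_Aut:
  assumes "\<phi> \<in> carrier (mla_Aut G)"
  shows "inv\<^bsub>mla_Aut G\<^esub> \<phi> = restrict (inv_into (carrier G) \<phi>) (carrier G)"
  using assms group.m_inv_consistent[OF group_BijGroup subgroup_mla_Aut, of \<phi>]
  by (simp add: mla_Aut_def inv_BijGroup)

text \<open>
  Requiring \<open>\<phi> ` N = N\<close> rather than \<open>\<phi> ` N \<subseteq> N\<close> is what makes inverses stabilise \<open>N\<close> again.
\<close>
lemma group_mla_Aut_stab:
  assumes N: "N \<subseteq> carrier G"
  shows "group (mla_Aut_stab N G)"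
proof -
  have "subgroup {\<phi> \<in> carrier (mla_Aut G). \<phi> ` N = N} (mla_Aut G)"
  proof (rule group.subgroupI[OF group_mla_Aut])
    have "\<one>\<^bsub>mla_Aut G\<^esub> \<in> {\<phi> \<in> carrier (mla_Aut G). \<phi> ` N = N}"
      using N group.is_monoid[OF group_mla_Aut]
      by (auto simp: monoid.one_closed) (auto simp: one_mla_Aut)
    then show "{\<phi> \<in> carrier (mla_Aut G). \<phi> ` N = N} \<noteq> {}" by blast
  next
    fix \<phi> assume \<phi>: "\<phi> \<in> {\<phi> \<in> carrier (mla_Aut G). \<phi> ` N = N}"
    have inj: "inj_on \<phi> (carrier G)" using \<phi> mla_AutD(4) by blast
    have "inv_into (carrier G) \<phi> ` N = N"
      using inv_into_image_cancel[OF inj N] \<phi> by simp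
    moreover have "restrict (inv_into (carrier G) \<phi>) (carrier G) ` N = inv_into (carrier G) \<phi> ` N"
      using N by (intro image_cong) auto
    ultimately show "inv\<^bsub>mla_Aut G\<^esub> \<phi> \<in> {\<phi> \<in> carrier (mla_Aut G). \<phi> ` N = N}"
      using \<phi> group.inv_closed[OF group_mla_Aut, of \<phi>] by (simp add: inv_mla_Aut)
  next
    fix \<phi> \<psi> assume a: "\<phi> \<in> {\<phi> \<in> carrier (mla_Aut G). \<phi> ` N = N}"
      "\<psi> \<in> {\<phi> \<in> carrier (mla_Aut G). \<phi> ` N = N}"
    have "compose (carrier G) \<phi> \<psi> ` N = \<phi> ` \<psi> ` N"
      using N by (force simp: compose_def)
    then show "\<phi> \<otimes>\<^bsub>mla_Aut G\<^esub> \<psi> \<in> {\<phi> \<in> carrier (mla_Aut G). \<phi> ` N = N}"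
      using a monoid.m_closed[OF group.is_monoid[OF group_mla_Aut], of \<phi> \<psi>]
      by (simp add: mult_mla_Aut)
  qed auto
  then show ?thesis
    using subgroup.subgroup_is_group[OF _ group_mla_Aut] by (simp add: mla_Aut_stab_def)
qed

end

section \<open>Cohomology with trivial coefficients\<close>

text \<open>
  The map \<open>\<Gamma>\<close> of a central extension is trivial, and its coefficient group is abelian. Each cocycle
  identity then compares two products of values of \<open>f\<close> and \<open>h\<close>, so cocycles are stable under
  pointwise products and under composition with an endomorphism of the coefficients, for instance
  inversion. Composition with an endomorphism of \<open>K\<close> only substitutes its arguments in the
  identities.
\<close>
locale trivial_coefficients = K: mult_lie_algebra K + H: comm_group H
  for K :: "('k, 'n) mla_scheme" (structure) and H :: "('h, 'l) mla_scheme" (structure) +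
  fixes \<Gamma> :: "'k \<Rightarrow> 'h \<Rightarrow> 'h"
  assumes trivial_action: "\<lbrakk>x \<in> carrier K; a \<in> carrier H\<rbrakk> \<Longrightarrow> \<Gamma> x a = \<one>\<^bsub>H\<^esub>"
begin

lemma carrier_Z1:
  "carrier (Z1_ML K H \<Gamma>) = {\<nu> \<in> carrier K \<rightarrow>\<^sub>E carrier H. \<forall>x\<in>carrier K. \<forall>y\<in>carrier K.
     \<nu> (x \<otimes>\<^bsub>K\<^esub> y) = \<nu> x \<otimes>\<^bsub>H\<^esub> \<nu> y \<and> \<nu> (x \<star>\<^bsub>K\<^esub> y) = \<one>\<^bsub>H\<^esub>}"
proof -
  have "\<Gamma> x (\<nu> y) \<otimes>\<^bsub>H\<^esub> \<Gamma> y (inv\<^bsub>H\<^esub> (\<nu> x)) = \<one>\<^bsub>H\<^esub>"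
    if "\<nu> \<in> carrier K \<rightarrow>\<^sub>E carrier H" "x \<in> carrier K" "y \<in> carrier K" for \<nu> x y
    using that by (simp add: trivial_action PiE_iff)
  then show ?thesis
    unfolding Z1_ML_def by (auto 0 3)
qed

lemma Z1_mult: "\<nu> \<otimes>\<^bsub>Z1_ML K H \<Gamma>\<^esub> \<mu> = (\<lambda>x\<in>carrier K. \<nu> x \<otimes>\<^bsub>H\<^esub> \<mu> x)"
  and Z1_one: "\<one>\<^bsub>Z1_ML K H \<Gamma>\<^esub> = (\<lambda>x\<in>carrier K. \<one>\<^bsub>H\<^esub>)"
  by (simp_all add: Z1_ML_def)

lemma comm_group_Z1: "comm_group (Z1_ML K H \<Gamma>)"
proof (rule comm_groupI)
  fix \<nu> \<mu> assume "\<nu> \<in> carrier (Z1_ML K H \<Gamma>)" "\<mu> \<in> carrier (Z1_ML K H \<Gamma>)"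
  then show "\<nu> \<otimes>\<^bsub>Z1_ML K H \<Gamma>\<^esub> \<mu> \<in> carrier (Z1_ML K H \<Gamma>)"
    by (auto simp: carrier_Z1 Z1_mult PiE_iff K.star_closed H.m_ac)
  show "\<nu> \<otimes>\<^bsub>Z1_ML K H \<Gamma>\<^esub> \<mu> = \<mu> \<otimes>\<^bsub>Z1_ML K H \<Gamma>\<^esub> \<nu>"
    using \<open>\<nu> \<in> _\<close> \<open>\<mu> \<in> _\<close> by (auto simp: carrier_Z1 Z1_mult PiE_iff H.m_comm intro!: restrict_ext)
next
  show "\<one>\<^bsub>Z1_ML K H \<Gamma>\<^esub> \<in> carrier (Z1_ML K H \<Gamma>)"
    by (auto simp: carrier_Z1 Z1_one K.star_closed)
next
  fix \<nu> \<mu> \<rho>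
  assume "\<nu> \<in> carrier (Z1_ML K H \<Gamma>)" "\<mu> \<in> carrier (Z1_ML K H \<Gamma>)" "\<rho> \<in> carrier (Z1_ML K H \<Gamma>)"
  then show "\<nu> \<otimes>\<^bsub>Z1_ML K H \<Gamma>\<^esub> \<mu> \<otimes>\<^bsub>Z1_ML K H \<Gamma>\<^esub> \<rho>
      = \<nu> \<otimes>\<^bsub>Z1_ML K H \<Gamma>\<^esub> (\<mu> \<otimes>\<^bsub>Z1_ML K H \<Gamma>\<^esub> \<rho>)"
    by (auto simp: carrier_Z1 Z1_mult PiE_iff H.m_assoc intro!: restrict_ext)
next
  fix \<nu> assume \<nu>: "\<nu> \<in> carrier (Z1_ML K H \<Gamma>)"
  have "(\<lambda>x\<in>carrier K. \<one>\<^bsub>H\<^esub> \<otimes>\<^bsub>H\<^esub> \<nu> x) = restrict \<nu> (carrier K)"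
    using \<nu> by (intro restrict_ext) (auto simp: carrier_Z1 PiE_iff)
  then show "\<one>\<^bsub>Z1_ML K H \<Gamma>\<^esub> \<otimes>\<^bsub>Z1_ML K H \<Gamma>\<^esub> \<nu> = \<nu>"
    using \<nu> by (auto simp: Z1_mult Z1_one carrier_Z1 cong: restrict_cong)
  show "\<exists>\<mu>\<in>carrier (Z1_ML K H \<Gamma>). \<mu> \<otimes>\<^bsub>Z1_ML K H \<Gamma>\<^esub> \<nu> = \<one>\<^bsub>Z1_ML K H \<Gamma>\<^esub>"
  proof
    show "(\<lambda>x\<in>carrier K. inv\<^bsub>H\<^esub> \<nu> x) \<in> carrier (Z1_ML K H \<Gamma>)"
      using \<nu> by (auto simp: carrier_Z1 PiE_iff K.star_closed H.inv_mult)
    show "(\<lambda>x\<in>carrier K. inv\<^bsub>H\<^esub> \<nu> x) \<otimes>\<^bsub>Z1_ML K H \<Gamma>\<^esub> \<nu> = \<one>\<^bsub>Z1_ML K H \<Gamma>\<^esub>"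
      using \<nu> by (auto simp: carrier_Z1 Z1_mult Z1_one PiE_iff intro!: restrict_ext)
  qed
qed

lemma conj_defect_closed:
  assumes "f \<in> carrier K \<times> carrier K \<rightarrow> carrier H" "z \<in> carrier K" "w \<in> carrier K"
  shows "conj_defect K H f z w \<in> carrier H"
  using assms by (simp add: conj_defect_def Pi_iff)

text \<open>
  What remains of the cocycle identities once the factors \<open>\<Gamma> _ _\<close> are trivial: associativity, the two
  distributive laws for \<open>\<star>\<close>, invariance of \<open>\<star>\<close> under conjugation, and the Jacobi identity, each read
  off in the \<open>H\<close>-coordinate.
\<close>
definition cocycle_identities :: "('k \<times> 'k \<Rightarrow> 'h) \<Rightarrow> ('k \<times> 'k \<Rightarrow> 'h) \<Rightarrow> 'k \<Rightarrow> 'k \<Rightarrow> 'k \<Rightarrow> bool" where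
  "cocycle_identities f h x y z \<longleftrightarrow>
     f (x, y) \<otimes>\<^bsub>H\<^esub> f (x \<otimes>\<^bsub>K\<^esub> y, z) = f (y, z) \<otimes>\<^bsub>H\<^esub> f (x, y \<otimes>\<^bsub>K\<^esub> z) \<and>
     conj_defect K H f y (x \<star>\<^bsub>K\<^esub> z) \<otimes>\<^bsub>H\<^esub> f (x \<star>\<^bsub>K\<^esub> y, conjg K y (x \<star>\<^bsub>K\<^esub> z)) \<otimes>\<^bsub>H\<^esub> h (x, y) \<otimes>\<^bsub>H\<^esub> h (x, z)
       = h (x, y \<otimes>\<^bsub>K\<^esub> z) \<and>
     conj_defect K H f x (y \<star>\<^bsub>K\<^esub> z) \<otimes>\<^bsub>H\<^esub> f (conjg K x (y \<star>\<^bsub>K\<^esub> z), x \<star>\<^bsub>K\<^esub> z) \<otimes>\<^bsub>H\<^esub> h (x, z) \<otimes>\<^bsub>H\<^esub> h (y, z)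
       = h (x \<otimes>\<^bsub>K\<^esub> y, z) \<and>
     h (conjg K z x, conjg K z y) = conj_defect K H f z (x \<star>\<^bsub>K\<^esub> y) \<otimes>\<^bsub>H\<^esub> h (x, y) \<and>
     h (x \<star>\<^bsub>K\<^esub> y, conjg K y z) \<otimes>\<^bsub>H\<^esub> h (y \<star>\<^bsub>K\<^esub> z, conjg K z x) \<otimes>\<^bsub>H\<^esub> h (z \<star>\<^bsub>K\<^esub> x, conjg K x y) \<otimes>\<^bsub>H\<^esub>
     f ((x \<star>\<^bsub>K\<^esub> y) \<star>\<^bsub>K\<^esub> conjg K y z, (y \<star>\<^bsub>K\<^esub> z) \<star>\<^bsub>K\<^esub> conjg K z x) \<otimes>\<^bsub>H\<^esub>
     f (inv\<^bsub>K\<^esub> ((z \<star>\<^bsub>K\<^esub> x) \<star>\<^bsub>K\<^esub> conjg K x y), (z \<star>\<^bsub>K\<^esub> x) \<star>\<^bsub>K\<^esub> conjg K x y) = \<one>\<^bsub>H\<^esub>"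

definition normalised :: "('k \<times> 'k \<Rightarrow> 'h) \<Rightarrow> ('k \<times> 'k \<Rightarrow> 'h) \<Rightarrow> bool" where
  "normalised f h \<longleftrightarrow> (\<forall>x\<in>carrier K. f (\<one>\<^bsub>K\<^esub>, x) = \<one>\<^bsub>H\<^esub> \<and> f (x, \<one>\<^bsub>K\<^esub>) = \<one>\<^bsub>H\<^esub> \<and>
     h (x, x) = \<one>\<^bsub>H\<^esub> \<and> h (x, \<one>\<^bsub>K\<^esub>) = \<one>\<^bsub>H\<^esub> \<and> h (\<one>\<^bsub>K\<^esub>, x) = \<one>\<^bsub>H\<^esub>)"

lemma cocycle2_iff:
  "cocycle2_ML K H \<Gamma> f h \<longleftrightarrow>
     f \<in> carrier K \<times> carrier K \<rightarrow>\<^sub>E carrier H \<and> h \<in> carrier K \<times> carrier K \<rightarrow>\<^sub>E carrier H \<and>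
     normalised f h \<and>
     (\<forall>x\<in>carrier K. \<forall>y\<in>carrier K. \<forall>z\<in>carrier K. cocycle_identities f h x y z)"
proof (cases "f \<in> carrier K \<times> carrier K \<rightarrow>\<^sub>E carrier H \<and> h \<in> carrier K \<times> carrier K \<rightarrow>\<^sub>E carrier H")
  case True
  then have mem: "f \<in> carrier K \<times> carrier K \<rightarrow> carrier H" "h \<in> carrier K \<times> carrier K \<rightarrow> carrier H"
    by (auto simp: PiE_def)
  have "\<And>p. p \<in> carrier K \<times> carrier K \<Longrightarrow> f p \<in> carrier H"
    "\<And>p. p \<in> carrier K \<times> carrier K \<Longrightarrow> h p \<in> carrier H"
    using mem by auto
  then show ?thesis
    using True mem unfolding cocycle2_ML_def normalised_def cocycle_identities_def
    by (simp add: trivial_action conj_defect_closed K.star_closed cong: ball_cong conj_cong)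
qed (auto simp: cocycle2_ML_def)

text \<open>
  \<open>conj_defect\<close> is multiplicative and natural in \<open>f\<close> because the coefficients commute; hence the
  identities containing it can be treated like those that contain only values of \<open>f\<close> and \<open>h\<close>.
\<close>
lemma conj_defect_mult:
  assumes "f \<in> carrier K \<times> carrier K \<rightarrow> carrier H" "f' \<in> carrier K \<times> carrier K \<rightarrow> carrier H"
    and "z \<in> carrier K" "w \<in> carrier K"
  shows "conj_defect K H (\<lambda>p\<in>carrier K \<times> carrier K. f p \<otimes>\<^bsub>H\<^esub> f' p) z w
    = conj_defect K H f z w \<otimes>\<^bsub>H\<^esub> conj_defect K H f' z w"
  using assms by (simp add: conj_defect_def Pi_iff H.inv_mult H.m_ac)

lemma conj_defect_push:
  assumes "f \<in> carrier K \<times> carrier K \<rightarrow> carrier H" "\<phi> \<in> hom H H"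
    and "z \<in> carrier K" "w \<in> carrier K"
  shows "conj_defect K H (\<lambda>p\<in>carrier K \<times> carrier K. \<phi> (f p)) z w = \<phi> (conj_defect K H f z w)"
proof -
  interpret \<phi>: group_hom H H \<phi> using assms by unfold_locales
  show ?thesis
    using assms by (simp add: conj_defect_def Pi_iff)
qed

lemma cocycle2_mult:
  assumes "cocycle2_ML K H \<Gamma> f h" "cocycle2_ML K H \<Gamma> f' h'"
  shows "cocycle2_ML K H \<Gamma> (\<lambda>p\<in>carrier K \<times> carrier K. f p \<otimes>\<^bsub>H\<^esub> f' p)
    (\<lambda>p\<in>carrier K \<times> carrier K. h p \<otimes>\<^bsub>H\<^esub> h' p)"
proof -
  have mem: "f \<in> carrier K \<times> carrier K \<rightarrow> carrier H" "f' \<in> carrier K \<times> carrier K \<rightarrow> carrier H"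
    "h \<in> carrier K \<times> carrier K \<rightarrow> carrier H" "h' \<in> carrier K \<times> carrier K \<rightarrow> carrier H"
    using assms by (auto simp: cocycle2_iff PiE_def)
  have cl: "\<And>p. p \<in> carrier K \<times> carrier K \<Longrightarrow> f p \<in> carrier H"
    "\<And>p. p \<in> carrier K \<times> carrier K \<Longrightarrow> f' p \<in> carrier H"
    "\<And>p. p \<in> carrier K \<times> carrier K \<Longrightarrow> h p \<in> carrier H"
    "\<And>p. p \<in> carrier K \<times> carrier K \<Longrightarrow> h' p \<in> carrier H"
    using mem by auto
  \<comment> \<open>Hiding the pointwise product behind \<open>D\<close> orients the interchange law as a rewrite rule.\<close>
  define D where "D a b = a \<otimes>\<^bsub>H\<^esub> b" for a b
  have interchange: "D a a' \<otimes>\<^bsub>H\<^esub> D b b' = D (a \<otimes>\<^bsub>H\<^esub> b) (a' \<otimes>\<^bsub>H\<^esub> b')"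
    if "a \<in> carrier H" "a' \<in> carrier H" "b \<in> carrier H" "b' \<in> carrier H" for a a' b b'
    using that by (simp add: D_def H.m_ac)
  have D_one: "D \<one>\<^bsub>H\<^esub> \<one>\<^bsub>H\<^esub> = \<one>\<^bsub>H\<^esub>" by (simp add: D_def)
  have id: "cocycle_identities (\<lambda>p\<in>carrier K \<times> carrier K. D (f p) (f' p))
      (\<lambda>p\<in>carrier K \<times> carrier K. D (h p) (h' p)) x y z"
    if xyz: "x \<in> carrier K" "y \<in> carrier K" "z \<in> carrier K" for x y z
  proof -
    have "cocycle_identities f h x y z" "cocycle_identities f' h' x y z"
      using assms xyz by (auto simp: cocycle2_iff)
    then show ?thesis
      unfolding cocycle_identities_def
      by (simp add: xyz cl mem conj_defect_mult[folded D_def] conj_defect_closed K.star_closed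
          interchange D_one)
  qed
  have "normalised f h" "normalised f' h'" using assms by (auto simp: cocycle2_iff)
  then have "normalised (\<lambda>p\<in>carrier K \<times> carrier K. f p \<otimes>\<^bsub>H\<^esub> f' p)
      (\<lambda>p\<in>carrier K \<times> carrier K. h p \<otimes>\<^bsub>H\<^esub> h' p)"
    by (simp add: normalised_def)
  then show ?thesis
    using id cl unfolding D_def by (simp add: cocycle2_iff)
qed

lemma cocycle2_push:
  assumes "cocycle2_ML K H \<Gamma> f h" "\<phi> \<in> hom H H"
  shows "cocycle2_ML K H \<Gamma> (\<lambda>p\<in>carrier K \<times> carrier K. \<phi> (f p)) (\<lambda>p\<in>carrier K \<times> carrier K. \<phi> (h p))"
proof -
  interpret \<phi>: group_hom H H \<phi> using assms by unfold_locales
  have mem: "f \<in> carrier K \<times> carrier K \<rightarrow> carrier H" "h \<in> carrier K \<times> carrier K \<rightarrow> carrier H"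
    using assms by (auto simp: cocycle2_iff PiE_def)
  have cl: "\<And>p. p \<in> carrier K \<times> carrier K \<Longrightarrow> f p \<in> carrier H"
    "\<And>p. p \<in> carrier K \<times> carrier K \<Longrightarrow> h p \<in> carrier H"
    using mem by auto
  have id: "cocycle_identities (\<lambda>p\<in>carrier K \<times> carrier K. \<phi> (f p))
      (\<lambda>p\<in>carrier K \<times> carrier K. \<phi> (h p)) x y z"
    if xyz: "x \<in> carrier K" "y \<in> carrier K" "z \<in> carrier K" for x y z
  proof -
    have "cocycle_identities f h x y z"
      using assms xyz by (auto simp: cocycle2_iff)
    then show ?thesis
      unfolding cocycle_identities_def
      by (simp add: xyz cl mem assms conj_defect_push conj_defect_closed K.star_closed
          flip: \<phi>.hom_mult)
  qed
  have "normalised f h" using assms by (auto simp: cocycle2_iff)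
  then have "normalised (\<lambda>p\<in>carrier K \<times> carrier K. \<phi> (f p)) (\<lambda>p\<in>carrier K \<times> carrier K. \<phi> (h p))"
    by (simp add: normalised_def)
  then show ?thesis
    using id cl by (simp add: cocycle2_iff)
qed

lemma cocycle2_pull:
  assumes "cocycle2_ML K H \<Gamma> f h" "\<eta> \<in> mla_hom K K"
  shows "cocycle2_ML K H \<Gamma> (\<lambda>(x, y)\<in>carrier K \<times> carrier K. f (\<eta> x, \<eta> y))
    (\<lambda>(x, y)\<in>carrier K \<times> carrier K. h (\<eta> x, \<eta> y))"
proof -
  interpret \<eta>: group_hom K K \<eta> using mla_homD(1)[OF assms(2)] by unfold_locales
  have conj: "\<eta> (conjg K x y) = conjg K (\<eta> x) (\<eta> y)" if "x \<in> carrier K" "y \<in> carrier K" for x y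
    using that by (simp add: conjg_def)
  have cl: "\<And>p. p \<in> carrier K \<times> carrier K \<Longrightarrow> f p \<in> carrier H"
    "\<And>p. p \<in> carrier K \<times> carrier K \<Longrightarrow> h p \<in> carrier H"
    using assms by (auto simp: cocycle2_iff)
  have cd: "conj_defect K H (\<lambda>(x, y)\<in>carrier K \<times> carrier K. f (\<eta> x, \<eta> y)) z w
      = conj_defect K H f (\<eta> z) (\<eta> w)" if "z \<in> carrier K" "w \<in> carrier K" for z w
    using that by (simp add: conj_defect_def)
  have id: "cocycle_identities (\<lambda>(x, y)\<in>carrier K \<times> carrier K. f (\<eta> x, \<eta> y))
      (\<lambda>(x, y)\<in>carrier K \<times> carrier K. h (\<eta> x, \<eta> y)) x y z"
    if xyz: "x \<in> carrier K" "y \<in> carrier K" "z \<in> carrier K" for x y z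
  proof -
    have "cocycle_identities f h (\<eta> x) (\<eta> y) (\<eta> z)"
      using assms(1) xyz by (auto simp: cocycle2_iff)
    then show ?thesis
      unfolding cocycle_identities_def
      by (simp add: xyz cd conj K.star_closed mla_homD(4)[OF assms(2)])
  qed
  have "normalised f h" using assms by (auto simp: cocycle2_iff)
  then have "normalised (\<lambda>(x, y)\<in>carrier K \<times> carrier K. f (\<eta> x, \<eta> y))
      (\<lambda>(x, y)\<in>carrier K \<times> carrier K. h (\<eta> x, \<eta> y))"
    by (simp add: normalised_def)
  then show ?thesis
    using id cl by (auto simp: cocycle2_iff)
qed

lemma inv_hom: "(\<lambda>a. inv\<^bsub>H\<^esub> a) \<in> hom H H"
  by (auto simp: hom_def H.inv_mult)

lemma Z2_carrier: "(f, h, \<Gamma>') \<in> carrier (Z2_ML K H \<Gamma>) \<longleftrightarrow> \<Gamma>' = \<Gamma> \<and> cocycle2_ML K H \<Gamma> f h"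
  by (auto simp: Z2_ML_def)

lemma Z2_mult: "(f, h, g) \<otimes>\<^bsub>Z2_ML K H \<Gamma>\<^esub> (f', h', g') =
    (\<lambda>p\<in>carrier K \<times> carrier K. f p \<otimes>\<^bsub>H\<^esub> f' p, \<lambda>p\<in>carrier K \<times> carrier K. h p \<otimes>\<^bsub>H\<^esub> h' p, \<Gamma>)"
  by (simp add: Z2_ML_def)

lemma Z2_one: "\<one>\<^bsub>Z2_ML K H \<Gamma>\<^esub> =
    (\<lambda>p\<in>carrier K \<times> carrier K. \<one>\<^bsub>H\<^esub>, \<lambda>p\<in>carrier K \<times> carrier K. \<one>\<^bsub>H\<^esub>, \<Gamma>)"
  by (simp add: Z2_ML_def)

lemma cocycle2_closed:
  assumes "cocycle2_ML K H \<Gamma> f h"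
  shows "f \<in> carrier K \<times> carrier K \<rightarrow>\<^sub>E carrier H" "h \<in> carrier K \<times> carrier K \<rightarrow>\<^sub>E carrier H"
    "p \<in> carrier K \<times> carrier K \<Longrightarrow> f p \<in> carrier H"
    "p \<in> carrier K \<times> carrier K \<Longrightarrow> h p \<in> carrier H"
  using assms by (auto simp: cocycle2_iff)

lemma comm_group_Z2: "comm_group (Z2_ML K H \<Gamma>)"
proof (rule comm_groupI, goal_cases)
  case (1 u v)
  then show ?case
    by (cases u; cases v) (auto simp: Z2_carrier Z2_mult cocycle2_mult)
next
  case 2
  have "cocycle2_ML K H \<Gamma> (\<lambda>p\<in>carrier K \<times> carrier K. \<one>\<^bsub>H\<^esub>) (\<lambda>p\<in>carrier K \<times> carrier K. \<one>\<^bsub>H\<^esub>)"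
    by (simp add: cocycle2_iff normalised_def cocycle_identities_def conj_defect_def K.star_closed)
  then show ?case by (simp add: Z2_one Z2_carrier)
next
  case (3 u v w)
  then show ?case
    by (cases u; cases v; cases w)
      (auto simp: Z2_carrier Z2_mult H.m_assoc cocycle2_closed intro!: restrict_ext)
next
  case (4 u v)
  then show ?case
    by (cases u; cases v)
      (auto simp: Z2_carrier Z2_mult H.m_comm cocycle2_closed intro!: restrict_ext)
next
  case (5 u)
  have "(\<lambda>p\<in>carrier K \<times> carrier K. (\<lambda>p\<in>carrier K \<times> carrier K. \<one>\<^bsub>H\<^esub>) p \<otimes>\<^bsub>H\<^esub> f p) = f"
    if "f \<in> carrier K \<times> carrier K \<rightarrow>\<^sub>E carrier H" for f
  proof -
    have "(\<lambda>p\<in>carrier K \<times> carrier K. (\<lambda>p\<in>carrier K \<times> carrier K. \<one>\<^bsub>H\<^esub>) p \<otimes>\<^bsub>H\<^esub> f p)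
        = restrict f (carrier K \<times> carrier K)"
      using that by (intro restrict_ext) (auto simp: PiE_iff)
    then show ?thesis using PiE_restrict[OF that] by simp
  qed
  then show ?case
    using 5 by (cases u)
      (auto simp: Z2_carrier Z2_mult Z2_one cocycle2_closed(1,2) simp del: restrict_apply)
next
  case (6 u)
  obtain f h where u: "u = (f, h, \<Gamma>)" and c: "cocycle2_ML K H \<Gamma> f h"
    using 6 by (cases u) (auto simp: Z2_carrier)
  show ?case
  proof
    show "(\<lambda>p\<in>carrier K \<times> carrier K. inv\<^bsub>H\<^esub> f p, \<lambda>p\<in>carrier K \<times> carrier K. inv\<^bsub>H\<^esub> h p, \<Gamma>)
        \<in> carrier (Z2_ML K H \<Gamma>)"
      using cocycle2_push[OF c inv_hom] by (simp add: Z2_carrier)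
    show "(\<lambda>p\<in>carrier K \<times> carrier K. inv\<^bsub>H\<^esub> f p, \<lambda>p\<in>carrier K \<times> carrier K. inv\<^bsub>H\<^esub> h p, \<Gamma>)
        \<otimes>\<^bsub>Z2_ML K H \<Gamma>\<^esub> u = \<one>\<^bsub>Z2_ML K H \<Gamma>\<^esub>"
      unfolding u using c by (auto simp: Z2_mult Z2_one cocycle2_closed intro!: restrict_ext)
  qed
qed

lemma B2_iff:
  "(f, h, \<Gamma>') \<in> B2_ML K H \<Gamma> \<longleftrightarrow> \<Gamma>' = \<Gamma> \<and> cocycle2_ML K H \<Gamma> f h \<and>
     (\<exists>l \<in> carrier K \<rightarrow> carrier H. l \<one>\<^bsub>K\<^esub> = \<one>\<^bsub>H\<^esub> \<and>
       (\<forall>x\<in>carrier K. \<forall>y\<in>carrier K.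
         f (x, y) = l x \<otimes>\<^bsub>H\<^esub> l y \<otimes>\<^bsub>H\<^esub> inv\<^bsub>H\<^esub> (l (x \<otimes>\<^bsub>K\<^esub> y)) \<and>
         h (x, y) = inv\<^bsub>H\<^esub> (l (x \<star>\<^bsub>K\<^esub> y))))"
proof -
  have "\<Gamma> x (l y) \<otimes>\<^bsub>H\<^esub> \<Gamma> y (inv\<^bsub>H\<^esub> (l x)) \<otimes>\<^bsub>H\<^esub> inv\<^bsub>H\<^esub> (l (x \<star>\<^bsub>K\<^esub> y)) = inv\<^bsub>H\<^esub> (l (x \<star>\<^bsub>K\<^esub> y))"
    if "l \<in> carrier K \<rightarrow> carrier H" "x \<in> carrier K" "y \<in> carrier K" for l x y
  proof -
    have "l x \<in> carrier H" "l y \<in> carrier H" "l (x \<star>\<^bsub>K\<^esub> y) \<in> carrier H"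
      using that by (auto simp: K.star_closed)
    then show ?thesis using that by (simp add: trivial_action)
  qed
  then show ?thesis
    unfolding B2_ML_def by (simp add: Z2_carrier cong: bex_cong ball_cong conj_cong)
qed

text \<open>
  The cochain \<open>l\<close> witnessing a coboundary depends multiplicatively on the coboundary: inverses and
  products of coboundaries are witnessed by the pointwise inverse and product of the \<open>l\<close>.
\<close>
lemma subgroup_B2: "subgroup (B2_ML K H \<Gamma>) (Z2_ML K H \<Gamma>)"
proof -
  interpret Z2: comm_group "Z2_ML K H \<Gamma>" by (rule comm_group_Z2)
  show ?thesis
  proof (rule Z2.subgroupI)
    show "B2_ML K H \<Gamma> \<subseteq> carrier (Z2_ML K H \<Gamma>)" by (auto simp: B2_ML_def)
    have "\<one>\<^bsub>Z2_ML K H \<Gamma>\<^esub> \<in> B2_ML K H \<Gamma>"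
      using Z2.one_closed unfolding Z2_one B2_iff Z2_carrier
      by (auto intro!: bexI[of _ "\<lambda>_. \<one>\<^bsub>H\<^esub>"])
    then show "B2_ML K H \<Gamma> \<noteq> {}" by blast
  next
    fix u assume "u \<in> B2_ML K H \<Gamma>"
    then obtain f h l where u: "u = (f, h, \<Gamma>)" and c: "cocycle2_ML K H \<Gamma> f h"
      and l: "l \<in> carrier K \<rightarrow> carrier H" "l \<one>\<^bsub>K\<^esub> = \<one>\<^bsub>H\<^esub>"
      and e: "\<And>x y. x \<in> carrier K \<Longrightarrow> y \<in> carrier K \<Longrightarrow>
         f (x, y) = l x \<otimes>\<^bsub>H\<^esub> l y \<otimes>\<^bsub>H\<^esub> inv\<^bsub>H\<^esub> (l (x \<otimes>\<^bsub>K\<^esub> y)) \<and> h (x, y) = inv\<^bsub>H\<^esub> (l (x \<star>\<^bsub>K\<^esub> y))"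
      by (cases u) (auto simp: B2_iff)
    have lc: "\<And>x. x \<in> carrier K \<Longrightarrow> l x \<in> carrier H" using l by auto
    let ?v = "(\<lambda>p\<in>carrier K \<times> carrier K. inv\<^bsub>H\<^esub> f p, \<lambda>p\<in>carrier K \<times> carrier K. inv\<^bsub>H\<^esub> h p, \<Gamma>)"
    have v: "?v \<in> B2_ML K H \<Gamma>"
      unfolding B2_iff using l(2) lc e
      by (auto simp: cocycle2_push[OF c inv_hom] K.star_closed H.inv_mult
          intro!: bexI[of _ "\<lambda>x. inv\<^bsub>H\<^esub> l x"])
    have "?v \<otimes>\<^bsub>Z2_ML K H \<Gamma>\<^esub> u = \<one>\<^bsub>Z2_ML K H \<Gamma>\<^esub>"
      unfolding u using c by (auto simp: Z2_mult Z2_one cocycle2_closed intro!: restrict_ext)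
    then have "inv\<^bsub>Z2_ML K H \<Gamma>\<^esub> u = ?v"
      using c cocycle2_push[OF c inv_hom] unfolding u
      by (intro Z2.inv_equality) (auto simp: Z2_carrier)
    then show "inv\<^bsub>Z2_ML K H \<Gamma>\<^esub> u \<in> B2_ML K H \<Gamma>" using v by simp
  next
    fix u v assume "u \<in> B2_ML K H \<Gamma>" "v \<in> B2_ML K H \<Gamma>"
    then obtain f h l f' h' l' where u: "u = (f, h, \<Gamma>)" and c: "cocycle2_ML K H \<Gamma> f h"
      and l: "l \<in> carrier K \<rightarrow> carrier H" "l \<one>\<^bsub>K\<^esub> = \<one>\<^bsub>H\<^esub>"
      and e: "\<And>x y. x \<in> carrier K \<Longrightarrow> y \<in> carrier K \<Longrightarrow>
         f (x, y) = l x \<otimes>\<^bsub>H\<^esub> l y \<otimes>\<^bsub>H\<^esub> inv\<^bsub>H\<^esub> (l (x \<otimes>\<^bsub>K\<^esub> y)) \<and> h (x, y) = inv\<^bsub>H\<^esub> (l (x \<star>\<^bsub>K\<^esub> y))"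
      and v: "v = (f', h', \<Gamma>)" and c': "cocycle2_ML K H \<Gamma> f' h'"
      and l': "l' \<in> carrier K \<rightarrow> carrier H" "l' \<one>\<^bsub>K\<^esub> = \<one>\<^bsub>H\<^esub>"
      and e': "\<And>x y. x \<in> carrier K \<Longrightarrow> y \<in> carrier K \<Longrightarrow>
         f' (x, y) = l' x \<otimes>\<^bsub>H\<^esub> l' y \<otimes>\<^bsub>H\<^esub> inv\<^bsub>H\<^esub> (l' (x \<otimes>\<^bsub>K\<^esub> y)) \<and>
         h' (x, y) = inv\<^bsub>H\<^esub> (l' (x \<star>\<^bsub>K\<^esub> y))"
      by (cases u; cases v) (auto simp: B2_iff)
    have lc: "\<And>x. x \<in> carrier K \<Longrightarrow> l x \<in> carrier H" "\<And>x. x \<in> carrier K \<Longrightarrow> l' x \<in> carrier H"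
      using l l' by auto
    show "u \<otimes>\<^bsub>Z2_ML K H \<Gamma>\<^esub> v \<in> B2_ML K H \<Gamma>"
      unfolding u v Z2_mult B2_iff using l(2) l'(2) lc e e'
      by (auto simp: cocycle2_mult[OF c c'] K.star_closed H.inv_mult H.m_ac
          intro!: bexI[of _ "\<lambda>x. l x \<otimes>\<^bsub>H\<^esub> l' x"])
  qed
qed

text \<open>
  The map \<open>\<chi>\<close> is given by left cosets, whereas the elements of a quotient group are right cosets; they
  agree because the group of cocycles is abelian.
\<close>
lemma coset_B2:
  assumes "u \<in> carrier (Z2_ML K H \<Gamma>)"
  shows "u <#\<^bsub>Z2_ML K H \<Gamma>\<^esub> B2_ML K H \<Gamma> \<in> carrier (H2_ML K H \<Gamma>)"
    and "u <#\<^bsub>Z2_ML K H \<Gamma>\<^esub> B2_ML K H \<Gamma> = \<one>\<^bsub>H2_ML K H \<Gamma>\<^esub> \<longleftrightarrow> u \<in> B2_ML K H \<Gamma>"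
proof -
  interpret Z2: comm_group "Z2_ML K H \<Gamma>" by (rule comm_group_Z2)
  interpret B2: subgroup "B2_ML K H \<Gamma>" "Z2_ML K H \<Gamma>" by (rule subgroup_B2)
  interpret normal "B2_ML K H \<Gamma>" "Z2_ML K H \<Gamma>"
    by (rule Z2.subgroup_imp_normal[OF subgroup_B2])
  have eq: "u <#\<^bsub>Z2_ML K H \<Gamma>\<^esub> B2_ML K H \<Gamma> = B2_ML K H \<Gamma> #>\<^bsub>Z2_ML K H \<Gamma>\<^esub> u"
    using coset_eq assms by blast
  show "u <#\<^bsub>Z2_ML K H \<Gamma>\<^esub> B2_ML K H \<Gamma> \<in> carrier (H2_ML K H \<Gamma>)"
    using Z2.rcosetsI[OF B2.subset assms] unfolding eq by (simp add: H2_ML_def FactGroup_def)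
  show "u <#\<^bsub>Z2_ML K H \<Gamma>\<^esub> B2_ML K H \<Gamma> = \<one>\<^bsub>H2_ML K H \<Gamma>\<^esub> \<longleftrightarrow> u \<in> B2_ML K H \<Gamma>"
    using Z2.coset_join1[OF _ assms subgroup_B2] Z2.coset_join2[OF assms subgroup_B2]
    unfolding eq by (auto simp: H2_ML_def FactGroup_def)
qed

end

section \<open>Coordinates on a central extension\<close>

locale transversal_extension = central_extension H G K \<iota> \<beta>
  for H :: "('h, 'l) mla_scheme" (structure) and G :: "('g, 'm) mla_scheme" (structure)
    and K :: "('k, 'n) mla_scheme" (structure) and \<iota> :: "'h \<Rightarrow> 'g" and \<beta> :: "'g \<Rightarrow> 'k" +
  fixes t :: "'k \<Rightarrow> 'g"
  assumes transversal: "transversal G K \<beta> t"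
begin

sublocale \<iota>: group_hom H G \<iota>
  using mla_homD(1)[OF incl_hom] by unfold_locales

sublocale \<beta>: group_hom G K \<beta>
  using mla_homD(1)[OF proj_hom] by unfold_locales

abbreviation f :: "'k \<times> 'k \<Rightarrow> 'h" where "f \<equiv> assoc_f H G K \<iota> t"
abbreviation h :: "'k \<times> 'k \<Rightarrow> 'h" where "h \<equiv> assoc_h H G K \<iota> t"
abbreviation \<Gamma> :: "'k \<Rightarrow> 'h \<Rightarrow> 'h" where "\<Gamma> \<equiv> assoc_\<Gamma> H G K \<iota> t"

lemma t_closed [simp, intro]: "x \<in> carrier K \<Longrightarrow> t x \<in> carrier G"
  and \<beta>_t [simp]: "x \<in> carrier K \<Longrightarrow> \<beta> (t x) = x"
  and t_one [simp]: "t \<one>\<^bsub>K\<^esub> = \<one>\<^bsub>G\<^esub>"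
  using transversal by (auto simp: transversal_def)

lemma \<iota>_central: "a \<in> carrier H \<Longrightarrow> \<iota> a \<in> grp_center G \<inter> lie_center G"
  using central by blast

lemma \<iota>_commute: "a \<in> carrier H \<Longrightarrow> g \<in> carrier G \<Longrightarrow> g \<otimes>\<^bsub>G\<^esub> \<iota> a = \<iota> a \<otimes>\<^bsub>G\<^esub> g"
  using \<iota>_central[of a] by (auto simp: grp_center_def)

lemma \<iota>_eq_iff: "a \<in> carrier H \<Longrightarrow> b \<in> carrier H \<Longrightarrow> \<iota> a = \<iota> b \<longleftrightarrow> a = b"
  using incl_inj by (auto dest: inj_onD)

lemma \<iota>_eq_one_iff: "a \<in> carrier H \<Longrightarrow> \<iota> a = \<one>\<^bsub>G\<^esub> \<longleftrightarrow> a = \<one>\<^bsub>H\<^esub>"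
  using \<iota>_eq_iff[of a "\<one>\<^bsub>H\<^esub>"] by simp

lemma \<beta>_\<iota> [simp]: "a \<in> carrier H \<Longrightarrow> \<beta> (\<iota> a) = \<one>\<^bsub>K\<^esub>"
  using incl_image by (auto simp: kernel_def)

lemma inv_\<iota>:
  assumes "g \<in> carrier G" "\<beta> g = \<one>\<^bsub>K\<^esub>"
  shows "inv_into (carrier H) \<iota> g \<in> carrier H" "\<iota> (inv_into (carrier H) \<iota> g) = g"
proof -
  have "g \<in> \<iota> ` carrier H" using assms incl_image by (auto simp: kernel_def)
  then show "inv_into (carrier H) \<iota> g \<in> carrier H" "\<iota> (inv_into (carrier H) \<iota> g) = g"
    by (auto intro: inv_into_into f_inv_into_f)
qed

sublocale H: comm_group H
proof (rule H.group_comm_groupI)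
  fix a b assume "a \<in> carrier H" "b \<in> carrier H"
  then show "a \<otimes>\<^bsub>H\<^esub> b = b \<otimes>\<^bsub>H\<^esub> a"
    using \<iota>_commute[of a "\<iota> b"] \<iota>_eq_iff[of "a \<otimes>\<^bsub>H\<^esub> b" "b \<otimes>\<^bsub>H\<^esub> a"] by simp
qed

lemma H_star: "a \<in> carrier H \<Longrightarrow> b \<in> carrier H \<Longrightarrow> a \<star>\<^bsub>H\<^esub> b = \<one>\<^bsub>H\<^esub>"
  using \<iota>_central[of a] \<iota>_eq_iff[of "a \<star>\<^bsub>H\<^esub> b" "\<one>\<^bsub>H\<^esub>"]
  by (simp add: H.star_closed mla_homD(4)[OF incl_hom] G.star_lie_center)

sublocale trivial_coefficients K H \<Gamma>
proof
  fix x a assume "x \<in> carrier K" "a \<in> carrier H"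
  then show "\<Gamma> x a = \<one>\<^bsub>H\<^esub>"
    using \<iota>_central[of a] inv_into_f_f[OF incl_inj H.one_closed]
    by (simp add: assoc_\<Gamma>_def G.star_lie_center)
qed

text \<open>
  The element of \<open>G\<close> with coordinates \<open>(a, x)\<close> under the bijection of \<open>H \<times> K\<close> with \<open>G\<close> that the
  transversal provides.
\<close>
definition elt :: "'h \<Rightarrow> 'k \<Rightarrow> 'g" where
  "elt a x = \<iota> a \<otimes>\<^bsub>G\<^esub> t x"

lemma elt_closed [simp, intro]: "a \<in> carrier H \<Longrightarrow> x \<in> carrier K \<Longrightarrow> elt a x \<in> carrier G"
  by (simp add: elt_def)

lemma \<beta>_elt [simp]: "a \<in> carrier H \<Longrightarrow> x \<in> carrier K \<Longrightarrow> \<beta> (elt a x) = x"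
  by (simp add: elt_def)

lemma elt_eq_iff:
  assumes "a \<in> carrier H" "b \<in> carrier H" "x \<in> carrier K" "y \<in> carrier K"
  shows "elt a x = elt b y \<longleftrightarrow> a = b \<and> x = y"
proof
  assume eq: "elt a x = elt b y"
  then have "x = y" using assms \<beta>_elt by metis
  with eq assms show "a = b \<and> x = y" by (simp add: elt_def \<iota>_eq_iff)
qed simp

lemma elt_one_left: "x \<in> carrier K \<Longrightarrow> elt \<one>\<^bsub>H\<^esub> x = t x"
  and elt_one_right: "a \<in> carrier H \<Longrightarrow> elt a \<one>\<^bsub>K\<^esub> = \<iota> a"
  by (simp_all add: elt_def)

lemma elt_cases:
  assumes g: "g \<in> carrier G"
  obtains a x where "a \<in> carrier H" "x \<in> carrier K" "g = elt a x"
proof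
  let ?a = "inv_into (carrier H) \<iota> (g \<otimes>\<^bsub>G\<^esub> inv\<^bsub>G\<^esub> (t (\<beta> g)))"
  have *: "g \<otimes>\<^bsub>G\<^esub> inv\<^bsub>G\<^esub> (t (\<beta> g)) \<in> carrier G" "\<beta> (g \<otimes>\<^bsub>G\<^esub> inv\<^bsub>G\<^esub> (t (\<beta> g))) = \<one>\<^bsub>K\<^esub>"
    using g by simp_all
  show "?a \<in> carrier H" "\<beta> g \<in> carrier K" using inv_\<iota>[OF *] g by auto
  show "g = elt ?a (\<beta> g)"
    using inv_\<iota>(2)[OF *] g by (simp add: elt_def G.m_assoc)
qed

lemma f_closed [simp, intro]: "x \<in> carrier K \<Longrightarrow> y \<in> carrier K \<Longrightarrow> f (x, y) \<in> carrier H"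
  and \<iota>_f: "x \<in> carrier K \<Longrightarrow> y \<in> carrier K \<Longrightarrow> t x \<otimes>\<^bsub>G\<^esub> t y = \<iota> (f (x, y)) \<otimes>\<^bsub>G\<^esub> t (x \<otimes>\<^bsub>K\<^esub> y)"
  using inv_\<iota>[of "t x \<otimes>\<^bsub>G\<^esub> t y \<otimes>\<^bsub>G\<^esub> inv\<^bsub>G\<^esub> (t (x \<otimes>\<^bsub>K\<^esub> y))"]
  by (simp_all add: assoc_f_def) (simp add: G.m_assoc)

lemma h_closed [simp, intro]: "x \<in> carrier K \<Longrightarrow> y \<in> carrier K \<Longrightarrow> h (x, y) \<in> carrier H"
  and \<iota>_h: "x \<in> carrier K \<Longrightarrow> y \<in> carrier K \<Longrightarrow> t x \<star>\<^bsub>G\<^esub> t y = \<iota> (h (x, y)) \<otimes>\<^bsub>G\<^esub> t (x \<star>\<^bsub>K\<^esub> y)"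
  using inv_\<iota>[of "(t x \<star>\<^bsub>G\<^esub> t y) \<otimes>\<^bsub>G\<^esub> inv\<^bsub>G\<^esub> (t (x \<star>\<^bsub>K\<^esub> y))"]
  by (simp_all add: assoc_h_def G.star_closed K.star_closed mla_homD(4)[OF proj_hom])
    (simp add: G.m_assoc G.star_closed K.star_closed)

lemma elt_mult:
  assumes "a \<in> carrier H" "b \<in> carrier H" "x \<in> carrier K" "y \<in> carrier K"
  shows "elt a x \<otimes>\<^bsub>G\<^esub> elt b y = elt (a \<otimes>\<^bsub>H\<^esub> b \<otimes>\<^bsub>H\<^esub> f (x, y)) (x \<otimes>\<^bsub>K\<^esub> y)"
proof -
  have "elt a x \<otimes>\<^bsub>G\<^esub> elt b y = \<iota> a \<otimes>\<^bsub>G\<^esub> (t x \<otimes>\<^bsub>G\<^esub> \<iota> b) \<otimes>\<^bsub>G\<^esub> t y"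
    using assms by (simp add: elt_def G.m_assoc)
  also have "\<dots> = \<iota> a \<otimes>\<^bsub>G\<^esub> \<iota> b \<otimes>\<^bsub>G\<^esub> (t x \<otimes>\<^bsub>G\<^esub> t y)"
    using assms by (simp add: \<iota>_commute[of b "t x"] G.m_assoc)
  also have "\<dots> = elt (a \<otimes>\<^bsub>H\<^esub> b \<otimes>\<^bsub>H\<^esub> f (x, y)) (x \<otimes>\<^bsub>K\<^esub> y)"
    using assms by (simp add: elt_def \<iota>_f G.m_assoc)
  finally show ?thesis .
qed

lemma elt_star:
  assumes "a \<in> carrier H" "b \<in> carrier H" "x \<in> carrier K" "y \<in> carrier K"
  shows "elt a x \<star>\<^bsub>G\<^esub> elt b y = elt (h (x, y)) (x \<star>\<^bsub>K\<^esub> y)"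
  using assms by (simp add: elt_def G.star_mult_central[OF \<iota>_central] \<iota>_h)

lemma f_normalised: "x \<in> carrier K \<Longrightarrow> f (\<one>\<^bsub>K\<^esub>, x) = \<one>\<^bsub>H\<^esub>" "x \<in> carrier K \<Longrightarrow> f (x, \<one>\<^bsub>K\<^esub>) = \<one>\<^bsub>H\<^esub>"
  using \<iota>_f[of "\<one>\<^bsub>K\<^esub>" x] \<iota>_f[of x "\<one>\<^bsub>K\<^esub>"] by (simp_all add: \<iota>_eq_one_iff)

lemma h_normalised: "x \<in> carrier K \<Longrightarrow> h (x, x) = \<one>\<^bsub>H\<^esub>"
  "x \<in> carrier K \<Longrightarrow> h (\<one>\<^bsub>K\<^esub>, x) = \<one>\<^bsub>H\<^esub>" "x \<in> carrier K \<Longrightarrow> h (x, \<one>\<^bsub>K\<^esub>) = \<one>\<^bsub>H\<^esub>"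
  using \<iota>_h[of x x, symmetric] \<iota>_h[of "\<one>\<^bsub>K\<^esub>" x, symmetric] \<iota>_h[of x "\<one>\<^bsub>K\<^esub>", symmetric]
  by (simp_all add: G.star_self K.star_self \<iota>_eq_one_iff)

lemma f_cocycle:
  assumes "x \<in> carrier K" "y \<in> carrier K" "z \<in> carrier K"
  shows "f (x, y) \<otimes>\<^bsub>H\<^esub> f (x \<otimes>\<^bsub>K\<^esub> y, z) = f (y, z) \<otimes>\<^bsub>H\<^esub> f (x, y \<otimes>\<^bsub>K\<^esub> z)"
proof -
  have "elt \<one>\<^bsub>H\<^esub> x \<otimes>\<^bsub>G\<^esub> elt \<one>\<^bsub>H\<^esub> y \<otimes>\<^bsub>G\<^esub> elt \<one>\<^bsub>H\<^esub> z = elt \<one>\<^bsub>H\<^esub> x \<otimes>\<^bsub>G\<^esub> (elt \<one>\<^bsub>H\<^esub> y \<otimes>\<^bsub>G\<^esub> elt \<one>\<^bsub>H\<^esub> z)"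
    using assms by (simp add: G.m_assoc)
  then show ?thesis
    using assms by (simp add: elt_mult elt_eq_iff)
qed

text \<open>
  The formula for \<open>conj_defect\<close> avoids \<open>inv (t z)\<close>. It is justified by moving the inverse to the other
  side, \<open>conjg K z w \<otimes> z = z \<otimes> w\<close>, and applying the cocycle law of \<open>f\<close> to triples containing \<open>z\<close> and
  \<open>inv z\<close>.
\<close>
lemma elt_conjg:
  assumes "a \<in> carrier H" "b \<in> carrier H" "z \<in> carrier K" "w \<in> carrier K"
  shows "conjg G (elt a z) (elt b w) = elt (conj_defect K H f z w \<otimes>\<^bsub>H\<^esub> b) (conjg K z w)"
proof -
  let ?d = "conj_defect K H f z w"
  have d: "?d \<in> carrier H" using assms by (simp add: conj_defect_def)
  have "f (inv\<^bsub>K\<^esub> z, z) \<otimes>\<^bsub>H\<^esub> f (\<one>\<^bsub>K\<^esub>, w) = f (z, w) \<otimes>\<^bsub>H\<^esub> f (inv\<^bsub>K\<^esub> z, z \<otimes>\<^bsub>K\<^esub> w)"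
    using f_cocycle[of "inv\<^bsub>K\<^esub> z" z w] assms by simp
  moreover have "f (z, inv\<^bsub>K\<^esub> z) = f (inv\<^bsub>K\<^esub> z, z)"
    using f_cocycle[of z "inv\<^bsub>K\<^esub> z" z] assms by (simp add: f_normalised)
  ultimately have swap: "f (z, inv\<^bsub>K\<^esub> z) = f (z, w) \<otimes>\<^bsub>H\<^esub> f (inv\<^bsub>K\<^esub> z, z \<otimes>\<^bsub>K\<^esub> w)"
    using assms by (simp add: f_normalised)
  have assoc: "f (conjg K z w, z) \<otimes>\<^bsub>H\<^esub> f (z \<otimes>\<^bsub>K\<^esub> w, inv\<^bsub>K\<^esub> z) = f (inv\<^bsub>K\<^esub> z, z)"
    using f_cocycle[of "z \<otimes>\<^bsub>K\<^esub> w" "inv\<^bsub>K\<^esub> z" z] assms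
    by (simp add: f_normalised conjg_def K.m_assoc H.m_comm)
  have "?d \<otimes>\<^bsub>H\<^esub> f (conjg K z w, z) = f (z, w)"
  proof -
    have "?d \<otimes>\<^bsub>H\<^esub> f (conjg K z w, z)
        = inv\<^bsub>H\<^esub> (f (inv\<^bsub>K\<^esub> z, z \<otimes>\<^bsub>K\<^esub> w)) \<otimes>\<^bsub>H\<^esub> (f (conjg K z w, z) \<otimes>\<^bsub>H\<^esub> f (z \<otimes>\<^bsub>K\<^esub> w, inv\<^bsub>K\<^esub> z))"
      using assms by (simp add: conj_defect_def H.m_ac)
    also have "\<dots> = inv\<^bsub>H\<^esub> (f (inv\<^bsub>K\<^esub> z, z \<otimes>\<^bsub>K\<^esub> w)) \<otimes>\<^bsub>H\<^esub> (f (inv\<^bsub>K\<^esub> z, z \<otimes>\<^bsub>K\<^esub> w) \<otimes>\<^bsub>H\<^esub> f (z, w))"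
      unfolding assoc using assms swap \<open>f (z, inv\<^bsub>K\<^esub> z) = f (inv\<^bsub>K\<^esub> z, z)\<close> by (simp add: H.m_comm)
    also have "\<dots> = f (z, w)"
      using assms by (simp flip: H.m_assoc)
    finally show ?thesis .
  qed
  then have "?d \<otimes>\<^bsub>H\<^esub> b \<otimes>\<^bsub>H\<^esub> a \<otimes>\<^bsub>H\<^esub> f (conjg K z w, z) = a \<otimes>\<^bsub>H\<^esub> b \<otimes>\<^bsub>H\<^esub> f (z, w)"
    using assms d by (metis (no_types, lifting) H.m_assoc H.m_comm H.m_closed K.conjg_closed f_closed)
  then have "elt (?d \<otimes>\<^bsub>H\<^esub> b) (conjg K z w) \<otimes>\<^bsub>G\<^esub> elt a z = elt a z \<otimes>\<^bsub>G\<^esub> elt b w"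
    using assms d by (simp add: elt_mult) (simp add: conjg_def K.m_assoc)
  then show ?thesis
    using assms d by (simp add: conjg_def[of G] G.inv_solve_right' K.conjg_closed)
qed

text \<open>
  Each cocycle identity is the \<open>H\<close>-coordinate of the corresponding axiom of \<open>G\<close>, applied to the
  representatives \<open>t x\<close>, \<open>t y\<close> and \<open>t z\<close>.
\<close>
lemma assoc_cocycle: "cocycle2_ML K H \<Gamma> f h"
proof -
  have d: "conj_defect K H f z w \<in> carrier H" if "z \<in> carrier K" "w \<in> carrier K" for z w
    using that by (simp add: conj_defect_def)
  have "cocycle_identities f h x y z" if xyz: "x \<in> carrier K" "y \<in> carrier K" "z \<in> carrier K" for x y z
  proof -
    let ?x = "elt \<one>\<^bsub>H\<^esub> x" and ?y = "elt \<one>\<^bsub>H\<^esub> y" and ?z = "elt \<one>\<^bsub>H\<^esub> z"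
    have xyzG: "?x \<in> carrier G" "?y \<in> carrier G" "?z \<in> carrier G" using xyz by auto
    note coords = xyz d elt_mult elt_star elt_conjg elt_eq_iff K.star_closed
    let ?A = "(x \<star>\<^bsub>K\<^esub> y) \<star>\<^bsub>K\<^esub> conjg K y z" and ?B = "(y \<star>\<^bsub>K\<^esub> z) \<star>\<^bsub>K\<^esub> conjg K z x"
      and ?C = "(z \<star>\<^bsub>K\<^esub> x) \<star>\<^bsub>K\<^esub> conjg K x y"
    have 2: "conj_defect K H f y (x \<star>\<^bsub>K\<^esub> z) \<otimes>\<^bsub>H\<^esub> f (x \<star>\<^bsub>K\<^esub> y, conjg K y (x \<star>\<^bsub>K\<^esub> z)) \<otimes>\<^bsub>H\<^esub> h (x, y) \<otimes>\<^bsub>H\<^esub> h (x, z)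
       = h (x, y \<otimes>\<^bsub>K\<^esub> z)"
      using G.star_mult_right[OF xyzG] by (simp add: coords H.m_ac)
    have 3: "conj_defect K H f x (y \<star>\<^bsub>K\<^esub> z) \<otimes>\<^bsub>H\<^esub> f (conjg K x (y \<star>\<^bsub>K\<^esub> z), x \<star>\<^bsub>K\<^esub> z) \<otimes>\<^bsub>H\<^esub> h (x, z) \<otimes>\<^bsub>H\<^esub> h (y, z)
       = h (x \<otimes>\<^bsub>K\<^esub> y, z)"
      using G.star_mult_left[OF xyzG] by (simp add: coords H.m_ac)
    have 4: "h (conjg K z x, conjg K z y) = conj_defect K H f z (x \<star>\<^bsub>K\<^esub> y) \<otimes>\<^bsub>H\<^esub> h (x, y)"
      using G.conjg_star[OF xyzG] by (simp add: coords)
    \<comment> \<open>The last factor \<open>f (inv C, C)\<close> of the Jacobi identity appears because the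
      product of the first two terms has \<open>K\<close>-coordinate \<open>inv C\<close>.\<close>
    have K_jac: "?A \<otimes>\<^bsub>K\<^esub> ?B = inv\<^bsub>K\<^esub> ?C"
      using K.star_jacobi[OF xyz] xyz by (intro K.inv_equality[symmetric]) (simp_all add: K.star_closed)
    have "elt (h (x \<star>\<^bsub>K\<^esub> y, conjg K y z) \<otimes>\<^bsub>H\<^esub> h (y \<star>\<^bsub>K\<^esub> z, conjg K z x) \<otimes>\<^bsub>H\<^esub> f (?A, ?B)
        \<otimes>\<^bsub>H\<^esub> h (z \<star>\<^bsub>K\<^esub> x, conjg K x y) \<otimes>\<^bsub>H\<^esub> f (inv\<^bsub>K\<^esub> ?C, ?C)) (inv\<^bsub>K\<^esub> ?C \<otimes>\<^bsub>K\<^esub> ?C) = \<one>\<^bsub>G\<^esub>"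
      using G.star_jacobi[OF xyzG] unfolding K_jac[symmetric]
      by (simp add: coords)
    then have 5: "h (x \<star>\<^bsub>K\<^esub> y, conjg K y z) \<otimes>\<^bsub>H\<^esub> h (y \<star>\<^bsub>K\<^esub> z, conjg K z x) \<otimes>\<^bsub>H\<^esub> h (z \<star>\<^bsub>K\<^esub> x, conjg K x y)
        \<otimes>\<^bsub>H\<^esub> f (?A, ?B) \<otimes>\<^bsub>H\<^esub> f (inv\<^bsub>K\<^esub> ?C, ?C) = \<one>\<^bsub>H\<^esub>"
      by (simp add: coords elt_one_right \<iota>_eq_one_iff H.m_ac del: \<iota>.hom_mult)
    show ?thesis
      unfolding cocycle_identities_def using f_cocycle[OF xyz] 2 3 4 5 by blast
  qed
  moreover have "normalised f h"
    by (simp add: normalised_def f_normalised h_normalised)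
  moreover have "f \<in> carrier K \<times> carrier K \<rightarrow>\<^sub>E carrier H" "h \<in> carrier K \<times> carrier K \<rightarrow>\<^sub>E carrier H"
    by (auto simp: PiE_def) (auto simp: assoc_f_def assoc_h_def)
  ultimately show ?thesis by (simp add: cocycle2_iff)
qed

section \<open>Automorphisms in coordinates\<close>

text \<open>
  A map acting as \<open>\<alpha>\<close> on \<open>H\<close> and as \<open>\<eta>\<close> on \<open>K\<close> is in coordinates \<open>(a, x) \<mapsto> (\<alpha> a \<otimes> l x, \<eta> x)\<close>, where
  \<open>l x\<close> records how far \<open>t x\<close> is moved away from \<open>t (\<eta> x)\<close>. The two equations below say that this map
  respects the product and \<open>\<star>\<close>. For \<open>\<alpha>\<close> and \<open>\<eta>\<close> the identity they characterise
  \<open>Z1_ML\<close>; in general they say that the coboundary of the pointwise inverse of \<open>l\<close>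
  is the cocycle defining \<open>\<chi> (\<alpha>, \<eta>)\<close>.
\<close>
definition compatible :: "('h \<Rightarrow> 'h) \<Rightarrow> ('k \<Rightarrow> 'k) \<Rightarrow> ('k \<Rightarrow> 'h) \<Rightarrow> bool" where
  "compatible \<alpha> \<eta> l \<longleftrightarrow> (\<forall>x\<in>carrier K. \<forall>y\<in>carrier K.
     l x \<otimes>\<^bsub>H\<^esub> l y \<otimes>\<^bsub>H\<^esub> f (\<eta> x, \<eta> y) = \<alpha> (f (x, y)) \<otimes>\<^bsub>H\<^esub> l (x \<otimes>\<^bsub>K\<^esub> y) \<and>
     h (\<eta> x, \<eta> y) = \<alpha> (h (x, y)) \<otimes>\<^bsub>H\<^esub> l (x \<star>\<^bsub>K\<^esub> y))"

definition H_coord :: "'g \<Rightarrow> 'h" where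
  "H_coord g = inv_into (carrier H) \<iota> (g \<otimes>\<^bsub>G\<^esub> inv\<^bsub>G\<^esub> (t (\<beta> g)))"

lemma H_coord_elt: "a \<in> carrier H \<Longrightarrow> x \<in> carrier K \<Longrightarrow> H_coord (elt a x) = a"
  by (simp add: H_coord_def G.m_assoc incl_inj) (simp add: elt_def G.m_assoc incl_inj)

definition twisted :: "('h \<Rightarrow> 'h) \<Rightarrow> ('k \<Rightarrow> 'k) \<Rightarrow> ('k \<Rightarrow> 'h) \<Rightarrow> 'g \<Rightarrow> 'g" where
  "twisted \<alpha> \<eta> l = (\<lambda>g\<in>carrier G. elt (\<alpha> (H_coord g) \<otimes>\<^bsub>H\<^esub> l (\<beta> g)) (\<eta> (\<beta> g)))"

lemma twisted_elt:
  "a \<in> carrier H \<Longrightarrow> x \<in> carrier K \<Longrightarrow> twisted \<alpha> \<eta> l (elt a x) = elt (\<alpha> a \<otimes>\<^bsub>H\<^esub> l x) (\<eta> x)"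
  by (simp add: twisted_def H_coord_elt)

lemma eq_on_elt:
  assumes "\<phi> \<in> extensional (carrier G)" "\<psi> \<in> extensional (carrier G)"
    and "\<And>a x. a \<in> carrier H \<Longrightarrow> x \<in> carrier K \<Longrightarrow> \<phi> (elt a x) = \<psi> (elt a x)"
  shows "\<phi> = \<psi>"
  using assms by (intro extensionalityI[of _ "carrier G"]) (auto elim: elt_cases)

lemma twisted_extensional: "twisted \<alpha> \<eta> l \<in> extensional (carrier G)"
  by (simp add: twisted_def)

text \<open>
  In \<open>elt a x \<otimes> elt b y\<close> the contributions of \<open>a\<close> and \<open>b\<close> are the same on both sides because \<open>\<alpha>\<close> is a
  homomorphism; in \<open>elt a x \<star> elt b y\<close> they do not occur. So the condition depends on \<open>x\<close> and \<open>y\<close> only.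
\<close>
lemma twisted_hom_iff:
  assumes \<alpha>: "\<alpha> \<in> hom H H" and \<eta>: "\<eta> \<in> mla_hom K K" and l: "l \<in> carrier K \<rightarrow> carrier H"
  shows "twisted \<alpha> \<eta> l \<in> mla_hom G G \<longleftrightarrow> compatible \<alpha> \<eta> l"
proof -
  interpret \<alpha>: group_hom H H \<alpha> using \<alpha> by unfold_locales
  have lc [simp]: "\<And>x. x \<in> carrier K \<Longrightarrow> l x \<in> carrier H" using l by auto
  have \<eta>c [simp]: "\<And>x. x \<in> carrier K \<Longrightarrow> \<eta> x \<in> carrier K" using mla_homD(2)[OF \<eta>] by simp
  note \<eta>_hom = mla_homD(3,4)[OF \<eta>]
  have mult: "twisted \<alpha> \<eta> l (elt a x \<otimes>\<^bsub>G\<^esub> elt b y) = twisted \<alpha> \<eta> l (elt a x) \<otimes>\<^bsub>G\<^esub> twisted \<alpha> \<eta> l (elt b y)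
      \<longleftrightarrow> l x \<otimes>\<^bsub>H\<^esub> l y \<otimes>\<^bsub>H\<^esub> f (\<eta> x, \<eta> y) = \<alpha> (f (x, y)) \<otimes>\<^bsub>H\<^esub> l (x \<otimes>\<^bsub>K\<^esub> y)"
    if [simp]: "a \<in> carrier H" "b \<in> carrier H" "x \<in> carrier K" "y \<in> carrier K" for a b x y
  proof -
    have "twisted \<alpha> \<eta> l (elt a x \<otimes>\<^bsub>G\<^esub> elt b y)
        = elt ((\<alpha> a \<otimes>\<^bsub>H\<^esub> \<alpha> b) \<otimes>\<^bsub>H\<^esub> (\<alpha> (f (x, y)) \<otimes>\<^bsub>H\<^esub> l (x \<otimes>\<^bsub>K\<^esub> y))) (\<eta> x \<otimes>\<^bsub>K\<^esub> \<eta> y)"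
      by (simp add: elt_mult twisted_elt \<eta>_hom H.m_assoc)
    moreover have "twisted \<alpha> \<eta> l (elt a x) \<otimes>\<^bsub>G\<^esub> twisted \<alpha> \<eta> l (elt b y)
        = elt ((\<alpha> a \<otimes>\<^bsub>H\<^esub> \<alpha> b) \<otimes>\<^bsub>H\<^esub> (l x \<otimes>\<^bsub>H\<^esub> l y \<otimes>\<^bsub>H\<^esub> f (\<eta> x, \<eta> y))) (\<eta> x \<otimes>\<^bsub>K\<^esub> \<eta> y)"
      by (simp add: elt_mult twisted_elt H.m_ac)
    ultimately show ?thesis by (auto simp: elt_eq_iff)
  qed
  have star: "twisted \<alpha> \<eta> l (elt a x \<star>\<^bsub>G\<^esub> elt b y) = twisted \<alpha> \<eta> l (elt a x) \<star>\<^bsub>G\<^esub> twisted \<alpha> \<eta> l (elt b y)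
      \<longleftrightarrow> h (\<eta> x, \<eta> y) = \<alpha> (h (x, y)) \<otimes>\<^bsub>H\<^esub> l (x \<star>\<^bsub>K\<^esub> y)"
    if [simp]: "a \<in> carrier H" "b \<in> carrier H" "x \<in> carrier K" "y \<in> carrier K" for a b x y
    by (auto simp: elt_star twisted_elt \<eta>_hom elt_eq_iff K.star_closed)
  show ?thesis
  proof
    assume hom: "twisted \<alpha> \<eta> l \<in> mla_hom G G"
    show "compatible \<alpha> \<eta> l"
      unfolding compatible_def
      using mult[OF H.one_closed H.one_closed] star[OF H.one_closed H.one_closed]
        mla_homD(3,4)[OF hom] by simp
  next
    assume "compatible \<alpha> \<eta> l"
    then have c: "\<And>x y. x \<in> carrier K \<Longrightarrow> y \<in> carrier K \<Longrightarrow>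
        l x \<otimes>\<^bsub>H\<^esub> l y \<otimes>\<^bsub>H\<^esub> f (\<eta> x, \<eta> y) = \<alpha> (f (x, y)) \<otimes>\<^bsub>H\<^esub> l (x \<otimes>\<^bsub>K\<^esub> y)"
      "\<And>x y. x \<in> carrier K \<Longrightarrow> y \<in> carrier K \<Longrightarrow> h (\<eta> x, \<eta> y) = \<alpha> (h (x, y)) \<otimes>\<^bsub>H\<^esub> l (x \<star>\<^bsub>K\<^esub> y)"
      by (auto simp: compatible_def)
    show "twisted \<alpha> \<eta> l \<in> mla_hom G G"
    proof (rule mla_homI)
      show "twisted \<alpha> \<eta> l g \<in> carrier G" if "g \<in> carrier G" for g
        by (rule elt_cases[OF that]) (simp add: twisted_elt)
      fix g g' assume g: "g \<in> carrier G" and g': "g' \<in> carrier G"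
      obtain a x where a_x: "a \<in> carrier H" "x \<in> carrier K" "g = elt a x" by (rule elt_cases[OF g])
      obtain b y where b_y: "b \<in> carrier H" "y \<in> carrier K" "g' = elt b y" by (rule elt_cases[OF g'])
      show "twisted \<alpha> \<eta> l (g \<otimes>\<^bsub>G\<^esub> g') = twisted \<alpha> \<eta> l g \<otimes>\<^bsub>G\<^esub> twisted \<alpha> \<eta> l g'"
        "twisted \<alpha> \<eta> l (g \<star>\<^bsub>G\<^esub> g') = twisted \<alpha> \<eta> l g \<star>\<^bsub>G\<^esub> twisted \<alpha> \<eta> l g'"
        using mult star c a_x b_y by auto
    qed
  qed
qed

lemma twisted_bij:
  assumes \<alpha>: "\<alpha> \<in> carrier (mla_Aut H)" and \<eta>: "\<eta> \<in> carrier (mla_Aut K)"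
    and l: "l \<in> carrier K \<rightarrow> carrier H"
  shows "twisted \<alpha> \<eta> l \<in> Bij (carrier G)"
proof -
  have lc [simp]: "\<And>x. x \<in> carrier K \<Longrightarrow> l x \<in> carrier H" using l by auto
  have cl [simp]: "\<And>a. a \<in> carrier H \<Longrightarrow> \<alpha> a \<in> carrier H" "\<And>x. x \<in> carrier K \<Longrightarrow> \<eta> x \<in> carrier K"
    using mla_homD(2)[OF mla_AutD(1)[OF \<alpha>]] mla_homD(2)[OF mla_AutD(1)[OF \<eta>]] by auto
  have inj: "inj_on (twisted \<alpha> \<eta> l) (carrier G)"
  proof (rule inj_onI)
    fix g g' assume g: "g \<in> carrier G" and g': "g' \<in> carrier G"
      and eq: "twisted \<alpha> \<eta> l g = twisted \<alpha> \<eta> l g'"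
    obtain a x where a_x: "a \<in> carrier H" "x \<in> carrier K" "g = elt a x" by (rule elt_cases[OF g])
    obtain b y where b_y: "b \<in> carrier H" "y \<in> carrier K" "g' = elt b y" by (rule elt_cases[OF g'])
    have e: "\<alpha> a \<otimes>\<^bsub>H\<^esub> l x = \<alpha> b \<otimes>\<^bsub>H\<^esub> l y" "\<eta> x = \<eta> y"
      using eq a_x b_y by (auto simp: twisted_elt elt_eq_iff)
    then have "x = y" using inj_onD[OF mla_AutD(4)[OF \<eta>]] a_x b_y by blast
    then have "\<alpha> a = \<alpha> b" using e a_x b_y by simp
    then show "g = g'" using inj_onD[OF mla_AutD(4)[OF \<alpha>]] \<open>x = y\<close> a_x b_y by blast
  qed
  have "twisted \<alpha> \<eta> l ` carrier G = carrier G"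
  proof
    show "twisted \<alpha> \<eta> l ` carrier G \<subseteq> carrier G"
      by (auto elim!: elt_cases simp: twisted_elt)
    show "carrier G \<subseteq> twisted \<alpha> \<eta> l ` carrier G"
    proof
      fix g assume g: "g \<in> carrier G"
      obtain b y where b_y: "b \<in> carrier H" "y \<in> carrier K" "g = elt b y" by (rule elt_cases[OF g])
      obtain x where x: "x \<in> carrier K" "y = \<eta> x"
        using mla_AutD(5)[OF \<eta>] b_y(2) by blast
      have "b \<otimes>\<^bsub>H\<^esub> inv\<^bsub>H\<^esub> l x \<in> carrier H" using b_y x by simp
      then obtain a where a: "a \<in> carrier H" "b \<otimes>\<^bsub>H\<^esub> inv\<^bsub>H\<^esub> l x = \<alpha> a"
        using mla_AutD(5)[OF \<alpha>] by blast
      have "twisted \<alpha> \<eta> l (elt a x) = g"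
        using a x b_y by (simp add: twisted_elt flip: a(2)) (simp add: H.m_assoc)
      then show "g \<in> twisted \<alpha> \<eta> l ` carrier G" using a x by force
    qed
  qed
  then show ?thesis using inj twisted_extensional by (simp add: Bij_def bij_betw_def)
qed

text \<open>
  The normalisation demanded of a coboundary witness is automatic: it is compatibility at
  \<open>x = y = \<one>\<close>.
\<close>
lemma compatible_one:
  assumes \<alpha>: "\<alpha> \<in> carrier (mla_Aut H)" and \<eta>: "\<eta> \<in> carrier (mla_Aut K)"
    and l: "l \<in> carrier K \<rightarrow> carrier H" and c: "compatible \<alpha> \<eta> l"
  shows "l \<one>\<^bsub>K\<^esub> = \<one>\<^bsub>H\<^esub>"
proof -
  interpret \<alpha>: group_hom H H \<alpha> using mla_homD(1)[OF mla_AutD(1)[OF \<alpha>]] by unfold_locales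
  interpret \<eta>: group_hom K K \<eta> using mla_homD(1)[OF mla_AutD(1)[OF \<eta>]] by unfold_locales
  have lc: "l \<one>\<^bsub>K\<^esub> \<in> carrier H" using l by auto
  have "l \<one>\<^bsub>K\<^esub> \<otimes>\<^bsub>H\<^esub> l \<one>\<^bsub>K\<^esub> \<otimes>\<^bsub>H\<^esub> f (\<eta> \<one>\<^bsub>K\<^esub>, \<eta> \<one>\<^bsub>K\<^esub>) = \<alpha> (f (\<one>\<^bsub>K\<^esub>, \<one>\<^bsub>K\<^esub>)) \<otimes>\<^bsub>H\<^esub> l (\<one>\<^bsub>K\<^esub> \<otimes>\<^bsub>K\<^esub> \<one>\<^bsub>K\<^esub>)"
    using c unfolding compatible_def by blast
  then show ?thesis using lc by (simp add: f_normalised)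
qed

abbreviation stab where "stab \<equiv> mla_Aut_stab (\<iota> ` carrier H) G"

lemma carrier_stab:
  "\<phi> \<in> carrier stab \<longleftrightarrow> \<phi> \<in> carrier (mla_Aut G) \<and> \<phi> ` \<iota> ` carrier H = \<iota> ` carrier H"
  by (simp add: mla_Aut_stab_def)

lemma twisted_stab:
  assumes \<alpha>: "\<alpha> \<in> carrier (mla_Aut H)" and \<eta>: "\<eta> \<in> carrier (mla_Aut K)"
    and l: "l \<in> carrier K \<rightarrow> carrier H" and c: "compatible \<alpha> \<eta> l"
  shows "twisted \<alpha> \<eta> l \<in> carrier stab" "\<Pi>_map H K \<iota> \<beta> t (twisted \<alpha> \<eta> l) = (\<alpha>, \<eta>)"
proof -
  interpret \<alpha>: group_hom H H \<alpha> using mla_homD(1)[OF mla_AutD(1)[OF \<alpha>]] by unfold_locales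
  interpret \<eta>: group_hom K K \<eta> using mla_homD(1)[OF mla_AutD(1)[OF \<eta>]] by unfold_locales
  have lc [simp]: "\<And>x. x \<in> carrier K \<Longrightarrow> l x \<in> carrier H" using l by auto
  have \<iota>: "twisted \<alpha> \<eta> l (\<iota> a) = \<iota> (\<alpha> a)" if "a \<in> carrier H" for a
    using that twisted_elt[of a "\<one>\<^bsub>K\<^esub>" \<alpha> \<eta> l] compatible_one[OF assms]
    by (simp add: elt_one_right)
  have "twisted \<alpha> \<eta> l ` \<iota> ` carrier H = \<iota> ` \<alpha> ` carrier H"
    using \<iota> by (force simp: image_image)
  then show "twisted \<alpha> \<eta> l \<in> carrier stab"
    using twisted_bij[OF \<alpha> \<eta> l] twisted_hom_iff[OF \<alpha>.homh mla_AutD(1)[OF \<eta>] l] c mla_AutD(5)[OF \<alpha>]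
    by (simp add: carrier_stab carrier_mla_Aut)
  have "twisted \<alpha> \<eta> l (t x) = elt (l x) (\<eta> x)" if "x \<in> carrier K" for x
    using that twisted_elt[of "\<one>\<^bsub>H\<^esub>" x \<alpha> \<eta> l] by (simp add: elt_one_left)
  then show "\<Pi>_map H K \<iota> \<beta> t (twisted \<alpha> \<eta> l) = (\<alpha>, \<eta>)"
    using mla_AutD(6)[OF \<alpha>] mla_AutD(6)[OF \<eta>] incl_inj
    by (auto simp: \<Pi>_map_def \<iota> intro!: extensionalityI[of _ "carrier H"] extensionalityI[of _ "carrier K"])
qed

text \<open>
  An automorphism that maps the kernel of \<open>\<beta>\<close> onto itself descends to \<open>K\<close>, which makes \<open>\<beta> \<circ> \<phi> \<circ> t\<close>
  independent of \<open>t\<close> and an automorphism. It is then of the twisted form, with \<open>l x\<close> the \<open>H\<close>-coordinate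
  of \<open>\<phi> (t x)\<close>.
\<close>
lemma \<Pi>_stab:
  assumes \<phi>: "\<phi> \<in> carrier stab" and \<Pi>: "\<Pi>_map H K \<iota> \<beta> t \<phi> = (\<alpha>, \<eta>)"
  shows \<Pi>_fst: "\<And>a. a \<in> carrier H \<Longrightarrow> \<alpha> a \<in> carrier H \<and> \<phi> (\<iota> a) = \<iota> (\<alpha> a)"
    and \<Pi>_snd: "\<And>g. g \<in> carrier G \<Longrightarrow> \<beta> (\<phi> g) = \<eta> (\<beta> g)"
    and \<Pi>_Aut: "\<alpha> \<in> carrier (mla_Aut H)" "\<eta> \<in> carrier (mla_Aut K)"
    and stab_twisted: "\<exists>l \<in> carrier K \<rightarrow>\<^sub>E carrier H. compatible \<alpha> \<eta> l \<and> \<phi> = twisted \<alpha> \<eta> l"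
proof -
  have A: "\<phi> \<in> carrier (mla_Aut G)" and im: "\<phi> ` \<iota> ` carrier H = \<iota> ` carrier H"
    using \<phi> by (auto simp: carrier_stab)
  have hom: "\<phi> \<in> mla_hom G G" and inj: "inj_on \<phi> (carrier G)" and surj: "\<phi> ` carrier G = carrier G"
    using mla_AutD[OF A] by auto
  interpret \<phi>: group_hom G G \<phi> using mla_homD(1)[OF hom] by unfold_locales
  have \<alpha>_def: "\<alpha> = (\<lambda>a\<in>carrier H. inv_into (carrier H) \<iota> (\<phi> (\<iota> a)))"
    and \<eta>_def: "\<eta> = (\<lambda>x\<in>carrier K. \<beta> (\<phi> (t x)))"
    using \<Pi> by (auto simp: \<Pi>_map_def)
  show \<phi>_\<iota>: "\<alpha> a \<in> carrier H \<and> \<phi> (\<iota> a) = \<iota> (\<alpha> a)" if "a \<in> carrier H" for a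
  proof -
    have "\<phi> (\<iota> a) \<in> \<iota> ` carrier H" using im that by blast
    then show ?thesis using that by (auto simp: \<alpha>_def f_inv_into_f inv_into_into)
  qed
  then have \<alpha>c [simp]: "\<And>a. a \<in> carrier H \<Longrightarrow> \<alpha> a \<in> carrier H" by blast
  have \<eta>c [simp]: "\<And>x. x \<in> carrier K \<Longrightarrow> \<eta> x \<in> carrier K" by (simp add: \<eta>_def)
  show \<beta>_\<phi>: "\<beta> (\<phi> g) = \<eta> (\<beta> g)" if g: "g \<in> carrier G" for g
  proof -
    obtain a x where a_x: "a \<in> carrier H" "x \<in> carrier K" "g = elt a x" by (rule elt_cases[OF g])
    have "\<phi> g = \<iota> (\<alpha> a) \<otimes>\<^bsub>G\<^esub> \<phi> (t x)" using a_x \<phi>_\<iota> by (simp add: elt_def)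
    then show ?thesis using a_x by (simp add: \<eta>_def)
  qed
  have \<alpha>_hom: "\<alpha> \<in> mla_hom H H"
  proof (rule mla_homI)
    fix a b assume ab: "a \<in> carrier H" "b \<in> carrier H"
    show "\<alpha> a \<in> carrier H" using ab by simp
    have "\<iota> (\<alpha> (a \<otimes>\<^bsub>H\<^esub> b)) = \<phi> (\<iota> (a \<otimes>\<^bsub>H\<^esub> b))" using ab \<phi>_\<iota>[of "a \<otimes>\<^bsub>H\<^esub> b"] by (simp del: \<iota>.hom_mult)
    also have "\<dots> = \<phi> (\<iota> a) \<otimes>\<^bsub>G\<^esub> \<phi> (\<iota> b)" using ab by simp
    also have "\<dots> = \<iota> (\<alpha> a \<otimes>\<^bsub>H\<^esub> \<alpha> b)" using ab \<phi>_\<iota> by simp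
    finally show "\<alpha> (a \<otimes>\<^bsub>H\<^esub> b) = \<alpha> a \<otimes>\<^bsub>H\<^esub> \<alpha> b" using ab \<iota>_eq_iff[of "\<alpha> (a \<otimes>\<^bsub>H\<^esub> b)" "\<alpha> a \<otimes>\<^bsub>H\<^esub> \<alpha> b"] by simp
    \<comment> \<open>On \<open>H\<close> the operation \<open>\<star>\<close> is constantly \<open>\<one>\<close>.\<close>
    have "\<alpha> \<one>\<^bsub>H\<^esub> = \<one>\<^bsub>H\<^esub>" using \<phi>_\<iota>[of "\<one>\<^bsub>H\<^esub>"] \<iota>_eq_one_iff[of "\<alpha> \<one>\<^bsub>H\<^esub>"] by simp
    then show "\<alpha> (a \<star>\<^bsub>H\<^esub> b) = \<alpha> a \<star>\<^bsub>H\<^esub> \<alpha> b" using ab by (simp add: H_star)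
  qed
  have \<alpha>_inj: "inj_on \<alpha> (carrier H)"
  proof (rule inj_onI)
    fix a b assume ab: "a \<in> carrier H" "b \<in> carrier H" "\<alpha> a = \<alpha> b"
    then have "\<phi> (\<iota> a) = \<phi> (\<iota> b)" using \<phi>_\<iota> by simp
    then have "\<iota> a = \<iota> b" using inj_onD[OF inj] ab by simp
    then show "a = b" using ab \<iota>_eq_iff by simp
  qed
  have \<alpha>_surj: "\<alpha> ` carrier H = carrier H"
  proof
    show "carrier H \<subseteq> \<alpha> ` carrier H"
    proof
      fix b assume b: "b \<in> carrier H"
      then obtain a where a: "a \<in> carrier H" "\<iota> b = \<phi> (\<iota> a)" using im by blast
      then have "b = \<alpha> a" using \<phi>_\<iota> b \<iota>_eq_iff by simp
      then show "b \<in> \<alpha> ` carrier H" using a by blast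
    qed
  qed auto
  show \<alpha>: "\<alpha> \<in> carrier (mla_Aut H)"
    using \<alpha>_hom \<alpha>_inj \<alpha>_surj by (simp add: carrier_mla_Aut Bij_def bij_betw_def) (simp add: \<alpha>_def)
  have \<eta>_hom: "\<eta> \<in> mla_hom K K"
  proof (rule mla_homI)
    fix x y assume xy: "x \<in> carrier K" "y \<in> carrier K"
    show "\<eta> x \<in> carrier K" using xy by simp
    show "\<eta> (x \<otimes>\<^bsub>K\<^esub> y) = \<eta> x \<otimes>\<^bsub>K\<^esub> \<eta> y"
      using \<beta>_\<phi>[of "t x \<otimes>\<^bsub>G\<^esub> t y"] \<beta>_\<phi>[of "t x"] \<beta>_\<phi>[of "t y"] xy by simp
    show "\<eta> (x \<star>\<^bsub>K\<^esub> y) = \<eta> x \<star>\<^bsub>K\<^esub> \<eta> y"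
      using \<beta>_\<phi>[of "t x \<star>\<^bsub>G\<^esub> t y"] \<beta>_\<phi>[of "t x"] \<beta>_\<phi>[of "t y"] xy
      by (simp add: G.star_closed mla_homD(4)[OF hom] mla_homD(4)[OF proj_hom])
  qed
  interpret \<eta>: group_hom K K \<eta> using mla_homD(1)[OF \<eta>_hom] by unfold_locales
  have \<eta>_inj: "inj_on \<eta> (carrier K)"
  proof (subst \<eta>.inj_on_one_iff, intro allI impI)
    fix x assume x: "x \<in> carrier K" "\<eta> x = \<one>\<^bsub>K\<^esub>"
    \<comment> \<open>Injectivity needs \<open>\<phi>\<close> to map the kernel of \<open>\<beta>\<close> onto itself: this forces \<open>t x\<close> into it.\<close>
    then have "\<phi> (t x) \<in> kernel G K \<beta>" using \<beta>_\<phi>[of "t x"] by (simp add: kernel_def)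
    then have "\<phi> (t x) \<in> \<phi> ` \<iota> ` carrier H" using im incl_image by simp
    then obtain a where "a \<in> carrier H" "\<phi> (t x) = \<phi> (\<iota> a)" by blast
    then have "t x = \<iota> a" using inj_onD[OF inj] x by simp
    then show "x = \<one>\<^bsub>K\<^esub>" using \<open>a \<in> _\<close> x \<beta>_t[of x] by simp
  qed
  have \<eta>_surj: "\<eta> ` carrier K = carrier K"
  proof
    show "carrier K \<subseteq> \<eta> ` carrier K"
    proof
      fix y assume y: "y \<in> carrier K"
      then have "t y \<in> \<phi> ` carrier G" using surj by simp
      then obtain g where g: "g \<in> carrier G" "t y = \<phi> g" by blast
      then have "y = \<eta> (\<beta> g)" using \<beta>_\<phi> y \<beta>_t[of y] by simp
      then show "y \<in> \<eta> ` carrier K" using g by simp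
    qed
  qed auto
  show \<eta>: "\<eta> \<in> carrier (mla_Aut K)"
    using \<eta>_hom \<eta>_inj \<eta>_surj by (simp add: carrier_mla_Aut Bij_def bij_betw_def) (simp add: \<eta>_def)
  define l where "l = (\<lambda>x\<in>carrier K. H_coord (\<phi> (t x)))"
  have l: "l x \<in> carrier H \<and> \<phi> (t x) = elt (l x) (\<eta> x)" if x: "x \<in> carrier K" for x
  proof -
    have "\<phi> (t x) \<in> carrier G" using x by simp
    then obtain a y where ay: "a \<in> carrier H" "y \<in> carrier K" "\<phi> (t x) = elt a y" by (rule elt_cases)
    then have "y = \<eta> x" using \<beta>_\<phi>[of "t x"] x by simp
    then show ?thesis using ay x by (simp add: l_def H_coord_elt)
  qed
  have lE: "l \<in> carrier K \<rightarrow>\<^sub>E carrier H" using l by (simp add: PiE_iff) (simp add: l_def)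
  have tw: "\<phi> = twisted \<alpha> \<eta> l"
  proof (rule eq_on_elt[OF mla_AutD(6)[OF A] twisted_extensional])
    fix a x assume a_x: "a \<in> carrier H" "x \<in> carrier K"
    then have "\<phi> (elt a x) = \<iota> (\<alpha> a) \<otimes>\<^bsub>G\<^esub> elt (l x) (\<eta> x)"
      using \<phi>_\<iota> l by (simp add: elt_def[of a])
    then show "\<phi> (elt a x) = twisted \<alpha> \<eta> l (elt a x)"
      using a_x l by (simp add: twisted_elt) (simp add: elt_def G.m_assoc)
  qed
  have "compatible \<alpha> \<eta> l"
    using twisted_hom_iff[OF mla_homD(1)[OF \<alpha>_hom] \<eta>_hom, of l] lE hom tw by (simp add: PiE_def)
  then show "\<exists>l \<in> carrier K \<rightarrow>\<^sub>E carrier H. compatible \<alpha> \<eta> l \<and> \<phi> = twisted \<alpha> \<eta> l"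
    using lE tw by blast
qed

section \<open>The exact sequence\<close>
lemma group_stab: "group stab"
  by (rule G.group_mla_Aut_stab) auto

lemma mult_stab: "\<phi> \<in> carrier stab \<Longrightarrow> \<psi> \<in> carrier stab \<Longrightarrow> \<phi> \<otimes>\<^bsub>stab\<^esub> \<psi> = compose (carrier G) \<phi> \<psi>"
  using mult_mla_Aut[of \<phi> G \<psi>] by (simp add: carrier_stab) (simp add: mla_Aut_stab_def)

lemma \<Pi>_group_hom: "group_hom stab (mla_Aut H \<times>\<times> mla_Aut K) (\<Pi>_map H K \<iota> \<beta> t)"
proof -
  have "\<Pi>_map H K \<iota> \<beta> t \<in> hom stab (mla_Aut H \<times>\<times> mla_Aut K)"
  proof (rule homI)
    fix \<phi> assume "\<phi> \<in> carrier stab"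
    then show "\<Pi>_map H K \<iota> \<beta> t \<phi> \<in> carrier (mla_Aut H \<times>\<times> mla_Aut K)"
      using \<Pi>_Aut[of \<phi>] by (cases "\<Pi>_map H K \<iota> \<beta> t \<phi>") auto
  next
    fix \<phi> \<psi> assume \<phi>: "\<phi> \<in> carrier stab" and \<psi>: "\<psi> \<in> carrier stab"
    obtain \<alpha> \<eta> where \<alpha>: "\<Pi>_map H K \<iota> \<beta> t \<phi> = (\<alpha>, \<eta>)" by fastforce
    obtain \<alpha>' \<eta>' where \<alpha>': "\<Pi>_map H K \<iota> \<beta> t \<psi> = (\<alpha>', \<eta>')" by fastforce
    note p = \<Pi>_stab[OF \<phi> \<alpha>] and q = \<Pi>_stab[OF \<psi> \<alpha>']
    have \<psi>c: "\<And>g. g \<in> carrier G \<Longrightarrow> \<psi> g \<in> carrier G"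
      using \<psi> mla_homD(2)[OF mla_AutD(1), of \<psi> G] by (simp add: carrier_stab)
    have "\<Pi>_map H K \<iota> \<beta> t (compose (carrier G) \<phi> \<psi>) = (compose (carrier H) \<alpha> \<alpha>', compose (carrier K) \<eta> \<eta>')"
      using p(1,2) q(1,2) \<psi>c incl_inj
      by (auto simp: \<Pi>_map_def compose_def intro!: restrict_ext)
    then show "\<Pi>_map H K \<iota> \<beta> t (\<phi> \<otimes>\<^bsub>stab\<^esub> \<psi>)
        = \<Pi>_map H K \<iota> \<beta> t \<phi> \<otimes>\<^bsub>mla_Aut H \<times>\<times> mla_Aut K\<^esub> \<Pi>_map H K \<iota> \<beta> t \<psi>"
      using p q \<phi> \<psi> by (simp add: mult_stab \<alpha> \<alpha>' mult_mla_Aut)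
  qed
  then show ?thesis
    by (intro group_hom.intro group_hom_axioms.intro group_stab DirProd_group
        H.group_mla_Aut K.group_mla_Aut)
qed

abbreviation id_H where "id_H \<equiv> \<one>\<^bsub>mla_Aut H\<^esub>"
abbreviation id_K where "id_K \<equiv> \<one>\<^bsub>mla_Aut K\<^esub>"

lemma id_Aut: "id_H \<in> carrier (mla_Aut H)" "id_K \<in> carrier (mla_Aut K)"
  using H.group_mla_Aut K.group_mla_Aut by (simp_all add: group.is_monoid monoid.one_closed)

lemma compatible_id_iff:
  assumes "\<nu> \<in> carrier K \<rightarrow>\<^sub>E carrier H"
  shows "compatible id_H id_K \<nu> \<longleftrightarrow> \<nu> \<in> carrier (Z1_ML K H \<Gamma>)"
proof -
  have cl: "\<And>x. x \<in> carrier K \<Longrightarrow> \<nu> x \<in> carrier H" using assms by (simp add: PiE_iff)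
  have "\<nu> x \<otimes>\<^bsub>H\<^esub> \<nu> y \<otimes>\<^bsub>H\<^esub> f (x, y) = f (x, y) \<otimes>\<^bsub>H\<^esub> \<nu> (x \<otimes>\<^bsub>K\<^esub> y) \<longleftrightarrow> \<nu> (x \<otimes>\<^bsub>K\<^esub> y) = \<nu> x \<otimes>\<^bsub>H\<^esub> \<nu> y"
    "h (x, y) = h (x, y) \<otimes>\<^bsub>H\<^esub> \<nu> (x \<star>\<^bsub>K\<^esub> y) \<longleftrightarrow> \<nu> (x \<star>\<^bsub>K\<^esub> y) = \<one>\<^bsub>H\<^esub>"
    if "x \<in> carrier K" "y \<in> carrier K" for x y
    using that cl[of x] cl[of y] cl[of "x \<otimes>\<^bsub>K\<^esub> y"] cl[of "x \<star>\<^bsub>K\<^esub> y"]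
    by (auto simp: H.m_comm[of _ "f (x, y)"] K.star_closed)
  then show ?thesis
    using assms by (simp add: compatible_def carrier_Z1 one_mla_Aut K.star_closed)
qed

text \<open>
  The equations prescribed for \<open>i \<nu>\<close> fix its value on every \<open>elt a x\<close>, hence everywhere; existence is
  the twisted map with \<open>\<alpha>\<close> and \<open>\<eta>\<close> the identity and \<open>l = \<nu>\<close>.
\<close>
lemma i_map_eq:
  assumes \<nu>: "\<nu> \<in> carrier (Z1_ML K H \<Gamma>)"
  shows "i_map H G K \<iota> t \<nu> = twisted id_H id_K \<nu>" "twisted id_H id_K \<nu> \<in> carrier stab"
    "\<Pi>_map H K \<iota> \<beta> t (twisted id_H id_K \<nu>) = (id_H, id_K)"
proof -
  have \<nu>E: "\<nu> \<in> carrier K \<rightarrow>\<^sub>E carrier H" using \<nu> by (simp add: carrier_Z1)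
  then have cl: "\<And>x. x \<in> carrier K \<Longrightarrow> \<nu> x \<in> carrier H" by (simp add: PiE_iff)
  have c: "compatible id_H id_K \<nu>" using compatible_id_iff[OF \<nu>E] \<nu> by simp
  show st: "twisted id_H id_K \<nu> \<in> carrier stab"
    and "\<Pi>_map H K \<iota> \<beta> t (twisted id_H id_K \<nu>) = (id_H, id_K)"
    using twisted_stab[OF id_Aut _ c] \<nu>E by (auto simp: PiE_def)
  have tw: "twisted id_H id_K \<nu> (elt a x) = elt (a \<otimes>\<^bsub>H\<^esub> \<nu> x) x"
    if "a \<in> carrier H" "x \<in> carrier K" for a x
    using that by (simp add: twisted_elt one_mla_Aut)
  have spec: "(\<forall>a\<in>carrier H. \<forall>x\<in>carrier K. \<phi> (\<iota> a \<otimes>\<^bsub>G\<^esub> t x) = \<iota> a \<otimes>\<^bsub>G\<^esub> \<iota> (\<nu> x) \<otimes>\<^bsub>G\<^esub> t x)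
      \<longleftrightarrow> (\<forall>a\<in>carrier H. \<forall>x\<in>carrier K. \<phi> (elt a x) = twisted id_H id_K \<nu> (elt a x))" for \<phi>
    by (simp add: tw) (simp add: elt_def cl)
  show "i_map H G K \<iota> t \<nu> = twisted id_H id_K \<nu>"
    unfolding i_map_def spec
  proof (rule the_equality)
    show "twisted id_H id_K \<nu> \<in> carrier (mla_Aut G) \<and>
      (\<forall>a\<in>carrier H. \<forall>x\<in>carrier K. twisted id_H id_K \<nu> (elt a x) = twisted id_H id_K \<nu> (elt a x))"
      using st by (simp add: carrier_stab)
    show "\<phi> = twisted id_H id_K \<nu>" if "\<phi> \<in> carrier (mla_Aut G) \<and>
      (\<forall>a\<in>carrier H. \<forall>x\<in>carrier K. \<phi> (elt a x) = twisted id_H id_K \<nu> (elt a x))" for \<phi>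
      using that mla_AutD(6)[of \<phi> G] twisted_extensional by (intro eq_on_elt) auto
  qed
qed

lemma i_map_elt:
  assumes "\<nu> \<in> carrier (Z1_ML K H \<Gamma>)" "a \<in> carrier H" "x \<in> carrier K"
  shows "i_map H G K \<iota> t \<nu> (elt a x) = elt (a \<otimes>\<^bsub>H\<^esub> \<nu> x) x"
  using assms by (simp add: i_map_eq twisted_elt one_mla_Aut)

lemma i_group_hom: "group_hom (Z1_ML K H \<Gamma>) stab (i_map H G K \<iota> t)"
proof -
  interpret Z1: comm_group "Z1_ML K H \<Gamma>" by (rule comm_group_Z1)
  have "i_map H G K \<iota> t \<in> hom (Z1_ML K H \<Gamma>) stab"
  proof (rule homI)
    show "i_map H G K \<iota> t \<nu> \<in> carrier stab" if "\<nu> \<in> carrier (Z1_ML K H \<Gamma>)" for \<nu>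
      using i_map_eq[OF that] by simp
    fix \<nu> \<mu> assume \<nu>: "\<nu> \<in> carrier (Z1_ML K H \<Gamma>)" and \<mu>: "\<mu> \<in> carrier (Z1_ML K H \<Gamma>)"
    have cl: "\<And>x. x \<in> carrier K \<Longrightarrow> \<nu> x \<in> carrier H" "\<And>x. x \<in> carrier K \<Longrightarrow> \<mu> x \<in> carrier H"
      using \<nu> \<mu> by (auto simp: carrier_Z1 PiE_iff)
    have "i_map H G K \<iota> t (\<nu> \<otimes>\<^bsub>Z1_ML K H \<Gamma>\<^esub> \<mu>) = compose (carrier G) (i_map H G K \<iota> t \<nu>) (i_map H G K \<iota> t \<mu>)"
    proof (rule eq_on_elt)
      show "i_map H G K \<iota> t (\<nu> \<otimes>\<^bsub>Z1_ML K H \<Gamma>\<^esub> \<mu>) \<in> extensional (carrier G)"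
        using Z1.m_closed[OF \<nu> \<mu>] by (simp add: i_map_eq twisted_extensional)
      show "i_map H G K \<iota> t (\<nu> \<otimes>\<^bsub>Z1_ML K H \<Gamma>\<^esub> \<mu>) (elt a x)
          = compose (carrier G) (i_map H G K \<iota> t \<nu>) (i_map H G K \<iota> t \<mu>) (elt a x)"
        if "a \<in> carrier H" "x \<in> carrier K" for a x
        using that \<nu> \<mu> Z1.m_closed[OF \<nu> \<mu>] cl
        by (simp add: i_map_elt compose_def) (simp add: Z1_mult H.m_ac)
    qed (simp add: compose_def)
    then show "i_map H G K \<iota> t (\<nu> \<otimes>\<^bsub>Z1_ML K H \<Gamma>\<^esub> \<mu>) = i_map H G K \<iota> t \<nu> \<otimes>\<^bsub>stab\<^esub> i_map H G K \<iota> t \<mu>"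
      using \<nu> \<mu> by (simp add: mult_stab i_map_eq)
  qed
  then show ?thesis
    by (intro group_hom.intro group_hom_axioms.intro group_stab Z1.group_axioms)
qed

lemma i_inj: "inj_on (i_map H G K \<iota> t) (carrier (Z1_ML K H \<Gamma>))"
proof (rule inj_onI)
  fix \<nu> \<mu> assume \<nu>: "\<nu> \<in> carrier (Z1_ML K H \<Gamma>)" and \<mu>: "\<mu> \<in> carrier (Z1_ML K H \<Gamma>)"
    and eq: "i_map H G K \<iota> t \<nu> = i_map H G K \<iota> t \<mu>"
  have E: "\<nu> \<in> carrier K \<rightarrow>\<^sub>E carrier H" "\<mu> \<in> carrier K \<rightarrow>\<^sub>E carrier H" using \<nu> \<mu> by (auto simp: carrier_Z1)
  show "\<nu> = \<mu>"
  proof (rule PiE_ext[OF E])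
    fix x assume x: "x \<in> carrier K"
    have "elt (\<nu> x) x = elt (\<mu> x) x"
      using i_map_elt[OF \<nu> H.one_closed x] i_map_elt[OF \<mu> H.one_closed x] eq E x by (simp add: PiE_iff)
    then show "\<nu> x = \<mu> x" using E x by (simp add: elt_eq_iff PiE_iff)
  qed
qed

lemma i_image_eq_kernel:
  "i_map H G K \<iota> t ` carrier (Z1_ML K H \<Gamma>) = kernel stab (mla_Aut H \<times>\<times> mla_Aut K) (\<Pi>_map H K \<iota> \<beta> t)"
proof
  show "i_map H G K \<iota> t ` carrier (Z1_ML K H \<Gamma>) \<subseteq> kernel stab (mla_Aut H \<times>\<times> mla_Aut K) (\<Pi>_map H K \<iota> \<beta> t)"
    by (auto simp: kernel_def i_map_eq)
  show "kernel stab (mla_Aut H \<times>\<times> mla_Aut K) (\<Pi>_map H K \<iota> \<beta> t) \<subseteq> i_map H G K \<iota> t ` carrier (Z1_ML K H \<Gamma>)"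
  proof
    fix \<phi> assume "\<phi> \<in> kernel stab (mla_Aut H \<times>\<times> mla_Aut K) (\<Pi>_map H K \<iota> \<beta> t)"
    then have "\<phi> \<in> carrier stab" "\<Pi>_map H K \<iota> \<beta> t \<phi> = (id_H, id_K)" by (auto simp: kernel_def)
    then obtain \<nu> where \<nu>: "\<nu> \<in> carrier K \<rightarrow>\<^sub>E carrier H" "compatible id_H id_K \<nu>" "\<phi> = twisted id_H id_K \<nu>"
      using stab_twisted by blast
    then have "\<nu> \<in> carrier (Z1_ML K H \<Gamma>)" using compatible_id_iff by blast
    then show "\<phi> \<in> i_map H G K \<iota> t ` carrier (Z1_ML K H \<Gamma>)" using \<nu>(3) i_map_eq(1) by force
  qed
qed

text \<open>
  The pair is the quotient of the pullback of \<open>(f, h)\<close> along \<open>\<eta>\<close> by its pushforward along \<open>\<alpha>\<close>, both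
  cocycles.
\<close>
lemma twist_diff_cocycle:
  assumes \<alpha>: "\<alpha> \<in> carrier (mla_Aut H)" and \<eta>: "\<eta> \<in> carrier (mla_Aut K)"
  shows "cocycle2_ML K H \<Gamma> (twist_diff H K f \<alpha> \<eta>) (twist_diff H K h \<alpha> \<eta>)"
proof -
  interpret \<alpha>: group_hom H H \<alpha> using mla_homD(1)[OF mla_AutD(1)[OF \<alpha>]] by unfold_locales
  have inv_\<alpha>: "(\<lambda>a. inv\<^bsub>H\<^esub> (\<alpha> a)) \<in> hom H H"
    by (auto simp: hom_def H.inv_mult)
  have "twist_diff H K u \<alpha> \<eta> = (\<lambda>p\<in>carrier K \<times> carrier K.
      (\<lambda>(x, y)\<in>carrier K \<times> carrier K. u (\<eta> x, \<eta> y)) p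
      \<otimes>\<^bsub>H\<^esub> (\<lambda>p\<in>carrier K \<times> carrier K. inv\<^bsub>H\<^esub> (\<alpha> (u p))) p)" for u
    by (auto simp: twist_diff_def intro!: restrict_ext)
  then show ?thesis
    using cocycle2_mult[OF cocycle2_pull[OF assoc_cocycle mla_AutD(1)[OF \<eta>]]
        cocycle2_push[OF assoc_cocycle inv_\<alpha>]] by simp
qed

text \<open>
  The coboundary equations for \<open>l\<close> divide by \<open>\<alpha> (f (x, y))\<close> and \<open>l (x \<otimes> y)\<close>, and by \<open>\<alpha> (h (x, y))\<close> and
  \<open>l (x \<star> y)\<close>. Written in terms of the pointwise inverse of \<open>l\<close> and cleared of denominators, they
  are the compatibility equations.
\<close>
lemma twist_diff_coboundary_iff:
  assumes \<alpha>: "\<alpha> \<in> carrier (mla_Aut H)" and \<eta>: "\<eta> \<in> carrier (mla_Aut K)"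
  shows "(twist_diff H K f \<alpha> \<eta>, twist_diff H K h \<alpha> \<eta>, \<Gamma>) \<in> B2_ML K H \<Gamma> \<longleftrightarrow>
    (\<exists>l \<in> carrier K \<rightarrow> carrier H. compatible \<alpha> \<eta> l)"
proof -
  interpret \<alpha>: group_hom H H \<alpha> using mla_homD(1)[OF mla_AutD(1)[OF \<alpha>]] by unfold_locales
  have \<eta>c [simp]: "\<And>x. x \<in> carrier K \<Longrightarrow> \<eta> x \<in> carrier K"
    using mla_homD(2)[OF mla_AutD(1)[OF \<eta>]] by auto
  have shift_f: "u \<otimes>\<^bsub>H\<^esub> inv\<^bsub>H\<^esub> v = inv\<^bsub>H\<^esub> a \<otimes>\<^bsub>H\<^esub> inv\<^bsub>H\<^esub> b \<otimes>\<^bsub>H\<^esub> inv\<^bsub>H\<^esub> (inv\<^bsub>H\<^esub> c) \<longleftrightarrow>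
      a \<otimes>\<^bsub>H\<^esub> b \<otimes>\<^bsub>H\<^esub> u = v \<otimes>\<^bsub>H\<^esub> c"
    if "u \<in> carrier H" "v \<in> carrier H" "a \<in> carrier H" "b \<in> carrier H" "c \<in> carrier H" for u v a b c
  proof -
    have cancel: "inv\<^bsub>H\<^esub> r \<otimes>\<^bsub>H\<^esub> (r \<otimes>\<^bsub>H\<^esub> s) = s" if "r \<in> carrier H" "s \<in> carrier H" for r s
      using that by (simp flip: H.m_assoc)
    \<comment> \<open>Multiplying both sides by \<open>?w\<close> clears the inverses.\<close>
    let ?w = "v \<otimes>\<^bsub>H\<^esub> (a \<otimes>\<^bsub>H\<^esub> b)"
    have "(u \<otimes>\<^bsub>H\<^esub> inv\<^bsub>H\<^esub> v) \<otimes>\<^bsub>H\<^esub> ?w = u \<otimes>\<^bsub>H\<^esub> (inv\<^bsub>H\<^esub> v \<otimes>\<^bsub>H\<^esub> (v \<otimes>\<^bsub>H\<^esub> (a \<otimes>\<^bsub>H\<^esub> b)))"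
      using that by (simp add: H.m_assoc)
    also have "\<dots> = a \<otimes>\<^bsub>H\<^esub> b \<otimes>\<^bsub>H\<^esub> u"
      using that by (simp add: cancel) (simp add: H.m_ac)
    finally have 1: "(u \<otimes>\<^bsub>H\<^esub> inv\<^bsub>H\<^esub> v) \<otimes>\<^bsub>H\<^esub> ?w = a \<otimes>\<^bsub>H\<^esub> b \<otimes>\<^bsub>H\<^esub> u" .
    have "(inv\<^bsub>H\<^esub> a \<otimes>\<^bsub>H\<^esub> inv\<^bsub>H\<^esub> b \<otimes>\<^bsub>H\<^esub> c) \<otimes>\<^bsub>H\<^esub> ?w
        = inv\<^bsub>H\<^esub> a \<otimes>\<^bsub>H\<^esub> (a \<otimes>\<^bsub>H\<^esub> (inv\<^bsub>H\<^esub> b \<otimes>\<^bsub>H\<^esub> (b \<otimes>\<^bsub>H\<^esub> (v \<otimes>\<^bsub>H\<^esub> c))))"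
      using that by (simp add: H.m_ac)
    also have "\<dots> = v \<otimes>\<^bsub>H\<^esub> c"
      using that by (simp add: cancel)
    finally have 2: "(inv\<^bsub>H\<^esub> a \<otimes>\<^bsub>H\<^esub> inv\<^bsub>H\<^esub> b \<otimes>\<^bsub>H\<^esub> c) \<otimes>\<^bsub>H\<^esub> ?w = v \<otimes>\<^bsub>H\<^esub> c" .
    show ?thesis
      using that H.right_cancel[of ?w "u \<otimes>\<^bsub>H\<^esub> inv\<^bsub>H\<^esub> v" "inv\<^bsub>H\<^esub> a \<otimes>\<^bsub>H\<^esub> inv\<^bsub>H\<^esub> b \<otimes>\<^bsub>H\<^esub> c"] unfolding 1 2
      by simp
  qed
  have shift_h: "u \<otimes>\<^bsub>H\<^esub> inv\<^bsub>H\<^esub> v = inv\<^bsub>H\<^esub> (inv\<^bsub>H\<^esub> c) \<longleftrightarrow> u = v \<otimes>\<^bsub>H\<^esub> c"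
    if "u \<in> carrier H" "v \<in> carrier H" "c \<in> carrier H" for u v c
    using that H.inv_solve_right'[of c u v] H.m_comm[of c v] by auto
  have bd: "compatible \<alpha> \<eta> (\<lambda>x. inv\<^bsub>H\<^esub> l x) \<longleftrightarrow> (\<forall>x\<in>carrier K. \<forall>y\<in>carrier K.
         twist_diff H K f \<alpha> \<eta> (x, y) = l x \<otimes>\<^bsub>H\<^esub> l y \<otimes>\<^bsub>H\<^esub> inv\<^bsub>H\<^esub> (l (x \<otimes>\<^bsub>K\<^esub> y)) \<and>
         twist_diff H K h \<alpha> \<eta> (x, y) = inv\<^bsub>H\<^esub> (l (x \<star>\<^bsub>K\<^esub> y)))"
    if l: "l \<in> carrier K \<rightarrow> carrier H" for l
  proof -
    have lc: "\<And>x. x \<in> carrier K \<Longrightarrow> l x \<in> carrier H" using l by auto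
    have "twist_diff H K f \<alpha> \<eta> (x, y) = l x \<otimes>\<^bsub>H\<^esub> l y \<otimes>\<^bsub>H\<^esub> inv\<^bsub>H\<^esub> (l (x \<otimes>\<^bsub>K\<^esub> y)) \<longleftrightarrow>
        inv\<^bsub>H\<^esub> l x \<otimes>\<^bsub>H\<^esub> inv\<^bsub>H\<^esub> l y \<otimes>\<^bsub>H\<^esub> f (\<eta> x, \<eta> y) = \<alpha> (f (x, y)) \<otimes>\<^bsub>H\<^esub> inv\<^bsub>H\<^esub> l (x \<otimes>\<^bsub>K\<^esub> y)"
      "twist_diff H K h \<alpha> \<eta> (x, y) = inv\<^bsub>H\<^esub> (l (x \<star>\<^bsub>K\<^esub> y)) \<longleftrightarrow>
        h (\<eta> x, \<eta> y) = \<alpha> (h (x, y)) \<otimes>\<^bsub>H\<^esub> inv\<^bsub>H\<^esub> l (x \<star>\<^bsub>K\<^esub> y)"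
      if "x \<in> carrier K" "y \<in> carrier K" for x y
      using that lc shift_f[of "f (\<eta> x, \<eta> y)" "\<alpha> (f (x, y))" "inv\<^bsub>H\<^esub> l x" "inv\<^bsub>H\<^esub> l y" "inv\<^bsub>H\<^esub> l (x \<otimes>\<^bsub>K\<^esub> y)"]
        shift_h[of "h (\<eta> x, \<eta> y)" "\<alpha> (h (x, y))" "inv\<^bsub>H\<^esub> l (x \<star>\<^bsub>K\<^esub> y)"]
      by (simp_all add: twist_diff_def K.star_closed)
    then show ?thesis by (simp add: compatible_def)
  qed
  show ?thesis
  proof
    assume "(twist_diff H K f \<alpha> \<eta>, twist_diff H K h \<alpha> \<eta>, \<Gamma>) \<in> B2_ML K H \<Gamma>"
    then obtain l where "l \<in> carrier K \<rightarrow> carrier H" "compatible \<alpha> \<eta> (\<lambda>x. inv\<^bsub>H\<^esub> l x)"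
      using bd by (auto simp: B2_iff)
    then show "\<exists>l \<in> carrier K \<rightarrow> carrier H. compatible \<alpha> \<eta> l"
      by (intro bexI[of _ "\<lambda>x. inv\<^bsub>H\<^esub> l x"]) auto
  next
    assume "\<exists>l \<in> carrier K \<rightarrow> carrier H. compatible \<alpha> \<eta> l"
    then obtain l where l: "l \<in> carrier K \<rightarrow> carrier H" and c: "compatible \<alpha> \<eta> l" by blast
    have lc: "\<And>x. x \<in> carrier K \<Longrightarrow> l x \<in> carrier H" using l by auto
    have "compatible \<alpha> \<eta> (\<lambda>x. inv\<^bsub>H\<^esub> (inv\<^bsub>H\<^esub> l x))"
      using c lc by (simp add: compatible_def K.star_closed)
    then show "(twist_diff H K f \<alpha> \<eta>, twist_diff H K h \<alpha> \<eta>, \<Gamma>) \<in> B2_ML K H \<Gamma>"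
      using bd[of "\<lambda>x. inv\<^bsub>H\<^esub> l x"] lc twist_diff_cocycle[OF \<alpha> \<eta>] compatible_one[OF \<alpha> \<eta> l c]
      by (auto simp: B2_iff intro!: bexI[of _ "\<lambda>x. inv\<^bsub>H\<^esub> l x"])
  qed
qed

lemma \<chi>_map_pair: "\<chi>_map H G K \<iota> t (\<alpha>, \<eta>) =
    (twist_diff H K f \<alpha> \<eta>, twist_diff H K h \<alpha> \<eta>, \<Gamma>) <#\<^bsub>Z2_ML K H \<Gamma>\<^esub> B2_ML K H \<Gamma>"
  by (simp add: \<chi>_map_def)

lemma \<chi>_closed: "\<chi>_map H G K \<iota> t \<in> carrier (mla_Aut H \<times>\<times> mla_Aut K) \<rightarrow> carrier (H2_ML K H \<Gamma>)"
  using coset_B2(1) twist_diff_cocycle by (auto simp: \<chi>_map_pair Z2_carrier)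

text \<open>
  Both sides say that some \<open>l\<close> is compatible with \<open>(\<alpha>, \<eta>)\<close>.
\<close>
lemma \<Pi>_image:
  "\<Pi>_map H K \<iota> \<beta> t ` carrier stab =
     {p \<in> carrier (mla_Aut H \<times>\<times> mla_Aut K). \<chi>_map H G K \<iota> t p = \<one>\<^bsub>H2_ML K H \<Gamma>\<^esub>}"
proof -
  have "(\<alpha>, \<eta>) \<in> \<Pi>_map H K \<iota> \<beta> t ` carrier stab \<longleftrightarrow> \<alpha> \<in> carrier (mla_Aut H) \<and> \<eta> \<in> carrier (mla_Aut K) \<and>
      \<chi>_map H G K \<iota> t (\<alpha>, \<eta>) = \<one>\<^bsub>H2_ML K H \<Gamma>\<^esub>" for \<alpha> \<eta>
  proof -
    have "(\<alpha>, \<eta>) \<in> \<Pi>_map H K \<iota> \<beta> t ` carrier stab \<longleftrightarrow> \<alpha> \<in> carrier (mla_Aut H) \<and> \<eta> \<in> carrier (mla_Aut K) \<and>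
        (\<exists>l \<in> carrier K \<rightarrow> carrier H. compatible \<alpha> \<eta> l)" (is "?L \<longleftrightarrow> ?R")
    proof
      assume ?L
      then obtain \<phi> where \<phi>: "\<phi> \<in> carrier stab" "\<Pi>_map H K \<iota> \<beta> t \<phi> = (\<alpha>, \<eta>)" by force
      show ?R using \<Pi>_Aut[OF \<phi>] stab_twisted[OF \<phi>] by (auto simp: PiE_def)
    next
      assume ?R
      then show ?L using twisted_stab[of \<alpha> \<eta>] by (auto intro!: rev_image_eqI)
    qed
    moreover have "\<chi>_map H G K \<iota> t (\<alpha>, \<eta>) = \<one>\<^bsub>H2_ML K H \<Gamma>\<^esub> \<longleftrightarrow> (\<exists>l \<in> carrier K \<rightarrow> carrier H. compatible \<alpha> \<eta> l)"
      if "\<alpha> \<in> carrier (mla_Aut H)" "\<eta> \<in> carrier (mla_Aut K)"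
      using twist_diff_coboundary_iff[OF that] twist_diff_cocycle[OF that]
      by (simp add: \<chi>_map_pair coset_B2(2) Z2_carrier)
    ultimately show ?thesis by blast
  qed
  then show ?thesis by auto
qed

end

theorem theorem3p9:
  fixes H :: "'h mla" and G :: "'g mla" and K :: "'k mla"
    and \<iota> :: "'h \<Rightarrow> 'g" and \<beta> :: "'g \<Rightarrow> 'k" and t :: "'k \<Rightarrow> 'g"
  assumes "central_extension H G K \<iota> \<beta>"
    and "transversal G K \<beta> t"
  shows
    "comm_group (Z1_ML K H (assoc_\<Gamma> H G K \<iota> t)) \<and>
     comm_group (Z2_ML K H (assoc_\<Gamma> H G K \<iota> t)) \<and>
     subgroup (B2_ML K H (assoc_\<Gamma> H G K \<iota> t)) (Z2_ML K H (assoc_\<Gamma> H G K \<iota> t)) \<and>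
     group_hom (Z1_ML K H (assoc_\<Gamma> H G K \<iota> t)) (mla_Aut_stab (\<iota> ` carrier H) G) (i_map H G K \<iota> t) \<and>
     group_hom (mla_Aut_stab (\<iota> ` carrier H) G) (mla_Aut H \<times>\<times> mla_Aut K) (\<Pi>_map H K \<iota> \<beta> t) \<and>
     \<chi>_map H G K \<iota> t \<in> carrier (mla_Aut H \<times>\<times> mla_Aut K) \<rightarrow> carrier (H2_ML K H (assoc_\<Gamma> H G K \<iota> t)) \<and>
     inj_on (i_map H G K \<iota> t) (carrier (Z1_ML K H (assoc_\<Gamma> H G K \<iota> t))) \<and>
     i_map H G K \<iota> t ` carrier (Z1_ML K H (assoc_\<Gamma> H G K \<iota> t)) =
       kernel (mla_Aut_stab (\<iota> ` carrier H) G) (mla_Aut H \<times>\<times> mla_Aut K) (\<Pi>_map H K \<iota> \<beta> t) \<and>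
     \<Pi>_map H K \<iota> \<beta> t ` carrier (mla_Aut_stab (\<iota> ` carrier H) G) =
       {p \<in> carrier (mla_Aut H \<times>\<times> mla_Aut K).
          \<chi>_map H G K \<iota> t p = \<one>\<^bsub>H2_ML K H (assoc_\<Gamma> H G K \<iota> t)\<^esub>}"
proof -
  interpret transversal_extension H G K \<iota> \<beta> t
    using assms by (intro transversal_extension.intro transversal_extension_axioms.intro)
  show ?thesis
    using comm_group_Z1 comm_group_Z2 subgroup_B2 i_group_hom \<Pi>_group_hom \<chi>_closed i_inj
      i_image_eq_kernel \<Pi>_image by blast
qed

end
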